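(* For any $(d_1,d_2)\in\mathbb Z^2$ and any $(p,q)\in\mathbb N^2$, \[ c(p,q)=\sum_{\omega}\mathrm{wt}(\omega), \] the sum over all compatible gradings $\omega$ on $\mathcal P([d_1]_+,[d_2]_+)$ with $\omega(\mathcal P_{\mathbf N})=p$ and $\omega(\mathcal P_{\mathbf E})=q$. Equivalently, $x[d_1,d_2]=x_1^{-d_1}x_2^{-d_2}\sum_\omega\mathrm{wt}(\omega)x_1^{\omega(\mathcal P_{\mathbf N})}x_2^{\omega(\mathcal P_{\mathbf E})}$, the sum over all compatible gradings on $\mathcal P([d_1]_+,[d_2]_+)$.
   Context: For $i=1,2$ let $p_{i,\bullet}=(p_{i,k})_{k=1}^{\ell_i}$, $\ell_i\in\mathbb Z_{\ge1}\cup\{\infty\}$, be independent variables; set $p_{i,0}=1$ and $p_{i,k}=0$ for $k>\ell_i$. For a sequence $p_\bullet=(p_k)_{k\ge1}$ and $m\ge0$ define polynomials $\pi_{m,n}(p_\bullet)$, $\varsigma_{m,n}(p_\bullet)$ by $(1+\sum_{k\ge1}p_kz^k)^m=\sum_{n\ge0}\pi_{m,n}(p_\bullet)z^n$ and $(1+\sum_{k\ge1}p_kz^k)^{-m}=\sum_{n\ge0}\varsigma_{m,n}(p_\bullet)z^n$, with the conventions $\pi_{m,0}=\varsigma_{m,0}=1$ for all $m\in\mathbb Z$ and $\pi_{m,n}=\varsigma_{m,n}=0$ for $m<0$, $n\ne0$. For integer polynomials $f,g$ in the variables $p_{i,k}$, $\operatorname{T\text{-}max}(f,g)=\sum_e\max([p^e]f,[p^e]g)\,p^e$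 (coefficientwise maximum over monomials $p^e$). Fix $(d_1,d_2)\in\mathbb Z^2$ and define $c(p,q)$ for $(p,q)\in\mathbb N^2$ recursively by $c(0,0)=1$ and $c(p,q)=\operatorname{T\text{-}max}\Bigl(\sum_{k=1}^p-c(p-k,q)\varsigma_{d_2-q,k}(p_{1,\bullet}),\ \sum_{k=1}^q-c(p,q-k)\varsigma_{d_1-p,k}(p_{2,\bullet})\Bigr).$ The greedy element is $x[d_1,d_2]=x_1^{-d_1}x_2^{-d_2}\sum_{(p,q)\in\mathbb N^2}c(p,q)x_1^px_2^q$. Here $[d]_+=\max(d,0)$. Dyck paths and gradings: for $d_1,d_2\ge0$, $\mathcal P(d_1,d_2)$ is the highest lattice path of unit east (horizontal) and north (vertical) edges from $(0,0)$ to $(d_1,d_2)$ never passing strictly above the segment joining them; horizontal edges $u_1,\dots,u_{d_1}$ left to right, vertical edges $v_1,\dots,v_{d_2}$ bottom to top; $\mathcal P_{\mathbf E},\mathcal P_{\mathbf N}$ the horizontal/vertical edge sets; for a set $C$ of edges $C_{\mathbf E},C_{\mathbf N}$ and $|C|$ as usual; $\overrightarrow{ef}$ is the set of edges from $e$ to $f$ along the path inclusive, continuing cyclically from the last edge to the first if $f$ comes before $e$. A grading is a map $\omega$ from edges to $\mathbb N$, $\omega(C)=\sum_{e\in C}\omega(e)$. It is compatible if for all $u\in\mathcal P_{\mathbf E}$, $v\in\mathcal P_{\mathbf N}$ with $\omega(u)\omega(v)>0$ some $e\in\overrightarrow{uv}$ satisfies either $e\in\mathcal P_{\mathbf N}\setminus\{v\}$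 and $|(\overrightarrow{ue})_{\mathbf N}|=\omega((\overrightarrow{ue})_{\mathbf E})$, or $e\in\mathcal P_{\mathbf E}\setminus\{u\}$ and $|(\overrightarrow{ev})_{\mathbf E}|=\omega((\overrightarrow{ev})_{\mathbf N})$. Weight: $\mathrm{wt}(\omega)=\prod_{i=1}^{d_1}p_{2,\omega(u_i)}\prod_{j=1}^{d_2}p_{1,\omega(v_j)}$. *)

theory Defs
  imports "HOL-Library.Poly_Mapping" "HOL-Library.Extended_Nat"
          "HOL-Computational_Algebra.Formal_Power_Series"
begin

text \<open>Integer polynomials in the variables p_{i,k}: a monomial is a finitely supported
  exponent vector indexed by (i,k); a polynomial is a finitely supported map from
  monomials to integer coefficients.\<close>

type_synonym mono = "(nat \<times> nat) \<Rightarrow>\<^sub>0 nat"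
type_synonym ipoly = "mono \<Rightarrow>\<^sub>0 int"

definition pvar :: "nat \<Rightarrow> nat \<Rightarrow> ipoly" where
  "pvar i k = Poly_Mapping.single (Poly_Mapping.single (i, k) 1) 1"

definition pseq :: "enat \<Rightarrow> nat \<Rightarrow> nat \<Rightarrow> ipoly" where
  "pseq l i k = (if k = 0 then 1 else if enat k \<le> l then pvar i k else 0)"

definition varsigma :: "int \<Rightarrow> nat \<Rightarrow> (nat \<Rightarrow> ipoly) \<Rightarrow> ipoly" where
  "varsigma m n s =
     (if m < 0 then (if n = 0 then 1 else 0)
      else fps_nth (THE G :: ipoly fps. G * (Abs_fps (\<lambda>k. if k = 0 then 1 else s k)) ^ nat m = 1) n)"

definition tmax :: "ipoly \<Rightarrow> ipoly \<Rightarrow> ipoly" where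
  "tmax f g = Abs_poly_mapping (\<lambda>e. max (Poly_Mapping.lookup f e) (Poly_Mapping.lookup g e))"

function cgr :: "int \<Rightarrow> int \<Rightarrow> enat \<Rightarrow> enat \<Rightarrow> nat \<Rightarrow> nat \<Rightarrow> ipoly" where
  "cgr d1 d2 l1 l2 p q =
     (if p = 0 \<and> q = 0 then 1
      else tmax (\<Sum>k\<in>{1..p}. - cgr d1 d2 l1 l2 (p - k) q * varsigma (d2 - int q) k (pseq l1 1))
                (\<Sum>k\<in>{1..q}. - cgr d1 d2 l1 l2 p (q - k) * varsigma (d1 - int p) k (pseq l2 2)))"
  by pat_completeness auto
termination
  by (relation "measure (\<lambda>(d1, d2, l1, l2, p, q). p + q)") auto

text \<open>The highest lattice path P(a,b) weakly below the segment from (0,0) to (a,b),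
  as a list of steps (True = north, False = east). Greedy: go north whenever the
  endpoint stays weakly below the segment.\<close>
fun path_aux :: "nat \<Rightarrow> nat \<Rightarrow> nat \<Rightarrow> nat \<Rightarrow> nat \<Rightarrow> bool list" where
  "path_aux a b x y 0 = []"
| "path_aux a b x y (Suc r) =
     (if y < b \<and> (y + 1) * a \<le> x * b then True # path_aux a b x (y + 1) r
      else False # path_aux a b (x + 1) y r)"

definition dyck_path :: "nat \<Rightarrow> nat \<Rightarrow> bool list" where
  "dyck_path a b = path_aux a b 0 0 (a + b)"

text \<open>Edges are indexed by their positions 0..<a+b along the path.\<close>
definition NE :: "bool list \<Rightarrow> nat set" where
  "NE P = {i. i < length P \<and> P ! i}"
definition EE :: "bool list \<Rightarrow> nat set" where
  "EE P = {i. i < length P \<and> \<not> P ! i}"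

definition arc :: "bool list \<Rightarrow> nat \<Rightarrow> nat \<Rightarrow> nat set" where
  "arc P e f = (if e \<le> f then {e..f} else {e..<length P} \<union> {0..f})"

definition compatible :: "bool list \<Rightarrow> (nat \<Rightarrow> nat) \<Rightarrow> bool" where
  "compatible P w \<longleftrightarrow>
     (\<forall>u\<in>EE P. \<forall>v\<in>NE P. w u * w v > 0 \<longrightarrow>
        (\<exists>e\<in>arc P u v.
           (e \<in> NE P - {v} \<and> card (arc P u e \<inter> NE P) = (\<Sum>x\<in>arc P u e \<inter> EE P. w x)) \<or>
           (e \<in> EE P - {u} \<and> card (arc P e v \<inter> EE P) = (\<Sum>x\<in>arc P e v \<inter> NE P. w x))))"

text \<open>Gradings on P are maps from the edges to nat; we represent them as functions
  on positions that vanish outside {0..<length P}.\<close>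
definition gradings :: "bool list \<Rightarrow> (nat \<Rightarrow> nat) set" where
  "gradings P = {w. \<forall>i. i \<ge> length P \<longrightarrow> w i = 0}"

definition wt :: "enat \<Rightarrow> enat \<Rightarrow> bool list \<Rightarrow> (nat \<Rightarrow> nat) \<Rightarrow> ipoly" where
  "wt l1 l2 P w = (\<Prod>i\<in>EE P. pseq l2 2 (w i)) * (\<Prod>j\<in>NE P. pseq l1 1 (w j))"

end

theory Submission
  imports Defs
begin

text \<open>
  For \<open>0 \<le> q \<le> d2\<close> the recursion says that the coefficient of \<open>x1\<close>-degree \<open>p\<close> of
  \<open>(\<Sum>p. c(p,q) x1^p) / P1(x1)^(d2 - q)\<close> and its counterpart with the two variables exchanged are
  coefficientwise nonnegative with disjoint supports, for all \<open>(p,q) \<noteq> (0,0)\<close>. On the combinatorial side,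
  a grading of the horizontal edges of total weight \<open>q\<close> shades exactly \<open>min q d2\<close> vertical
  edges, and the values of a compatible grading on the unshaded vertical edges are arbitrary. So
  dividing by \<open>P1^(d2 - q)\<close> leaves the sum over the \<^emph>\<open>tight\<close> gradings, those which vanish on the
  unshaded vertical edges; this is nonnegative. A nonzero tight grading satisfies
  \<open>p * d2 < q * d1\<close>, and reversing the path while exchanging horizontal and vertical edges gives
  the opposite strict inequality for the other quotient, so at most one of the two is nonzero.
\<close>

section \<open>Arcs and periodic partial sums\<close>

text \<open>The two balance conditions live on cyclic arcs. They become tractable once the path is
  unrolled to a walk over the natural numbers, the \<open>load\<close>, which gains
  \<open>w u\<close> at an east edge and loses one at a north edge: since descents have size one,
  balance of an arc becomes a first return, and shading becomes a statement on running minima. The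
  sign of the drift per turn, total horizontal weight minus \<open>card (NE P)\<close>, separates a
  light from a heavy case. One power of the generating series serves all gradings of given
  horizontal weight because the number of unshaded north edges depends on that weight alone and not
  on how it is distributed. The slope estimate sees a Dyck path only through the self-dual condition
  \<open>hugging\<close>, which is what lets it be applied to the reversed path. Negative
  \<open>d1\<close>, \<open>d2\<close> and degrees beyond them are covered by truncated subtraction,
  which matches the conventions for \<open>varsigma\<close>.\<close>

definition psum :: "(nat \<Rightarrow> int) \<Rightarrow> nat \<Rightarrow> nat \<Rightarrow> int" where
  "psum f n t = (\<Sum>i<t. f (i mod n))"

lemma psum_0 [simp]: "psum f n 0 = 0"
  by (simp add: psum_def)

lemma psum_Suc: "psum f n (Suc t) = psum f n t + f (t mod n)"
  by (simp add: psum_def)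

lemma window_sum:
  fixes f :: "nat \<Rightarrow> 'a::ab_group_add"
  shows "(\<Sum>i\<in>{c..<c+n}. f (i mod n)) = (\<Sum>i<n. f i)"
proof (induction c)
  case 0
  then show ?case by (simp add: lessThan_atLeast0)
next
  case (Suc c)
  show ?case
  proof (cases "n = 0")
    case False
    have "(\<Sum>i\<in>{c..<Suc (c+n)}. f (i mod n)) = (\<Sum>i\<in>{c..<c+n}. f (i mod n)) + f ((c+n) mod n)"
      by simp
    moreover have "(\<Sum>i\<in>{c..<Suc (c+n)}. f (i mod n)) = f (c mod n) + (\<Sum>i\<in>{Suc c..<Suc (c+n)}. f (i mod n))"
      by (rule sum.atLeast_Suc_lessThan) simp
    ultimately show ?thesis using Suc by simp
  qed simp
qed

lemma psum_diff: "x \<le> y \<Longrightarrow> psum f n y - psum f n x = (\<Sum>i\<in>{x..<y}. f (i mod n))"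
  unfolding psum_def
  by (simp add: lessThan_atLeast0 sum_diff_nat_ivl)

lemma psum_add_period: "psum f n (t + n) = psum f n t + (\<Sum>i<n. f i)"
  using psum_diff[of t "t+n" f n] window_sum[of f n t] by simp

lemma psum_add_periods: "psum f n (t + k * n) = psum f n t + int k * (\<Sum>i<n. f i)"
proof (induction k)
  case (Suc k)
  have "t + Suc k * n = (t + k * n) + n" by simp
  then show ?case using Suc psum_add_period[of f n "t + k*n"]
    by (simp add: algebra_simps)
qed simp

lemma inj_on_mod: "y < x + n \<Longrightarrow> inj_on (\<lambda>i::nat. i mod n) {x..y}"
proof (rule inj_onI)
  fix i j assume *: "y < x + n" "i \<in> {x..y}" "j \<in> {x..y}" "i mod n = j mod n"
  have eq: "i = j" if "i \<le> j" "i mod n = j mod n" "j < i + n" for i j :: nat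
  proof -
    have "n dvd j - i" using that mod_eq_dvd_iff_nat[of i j n] by simp
    moreover have "j - i < n" using that by auto
    ultimately have "j - i = 0" using nat_dvd_not_less[of "j - i" n] by blast
    then show ?thesis using that by simp
  qed
  have "j < i + n" "i < j + n" using * by auto
  then show "i = j" using eq[OF _ *(4)] eq[OF _ *(4)[symmetric]] by (metis nat_le_linear)
qed

text \<open>Cyclic arcs become ordinary intervals: a shift by whole periods reduces to
  \<open>x < length P\<close>, where an interval that passes the end of the path wraps once. The
  bound on \<open>y\<close> keeps the window from covering an edge twice.\<close>

lemma arc_mod_image:
  assumes "x \<le> y" "y < x + length P"
  shows "arc P (x mod length P) (y mod length P) = (\<lambda>i. i mod length P) ` {x..y}"
proof -
  let ?n = "length P"
  have n: "?n > 0" using assms by auto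
  have base: "arc P x (y mod ?n) = (\<lambda>i. i mod ?n) ` {x..y}"
    if "x < ?n" "x \<le> y" "y < x + ?n" for x y
  proof (cases "y < ?n")
    case True
    then show ?thesis using that by (auto simp: arc_def image_iff)
  next
    case False
    then have ym: "y mod ?n = y - ?n" using that by (simp add: mod_if)
    have "{x..y} = {x..<?n} \<union> {?n..y}" using that False by auto
    moreover have "(\<lambda>i. i mod ?n) ` {x..<?n} = {x..<?n}" by (auto simp: image_iff)
    moreover have "(\<lambda>i. i mod ?n) ` {?n..y} = {0..y-?n}"
    proof -
      have "{?n..y} = (\<lambda>i. i + ?n) ` {0..y-?n}" using False by simp
      then have "(\<lambda>i. i mod ?n) ` {?n..y} = (\<lambda>i. i mod ?n) ` {0..y-?n}"
        by (simp only: image_image) simp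
      also have "\<dots> = {0..y-?n}" using that by (auto simp: image_iff)
      finally show ?thesis .
    qed
    ultimately show ?thesis using ym that by (auto simp: arc_def image_Un)
  qed
  define k where "k = x div ?n"
  define x' y' where "x' = x - k * ?n" and "y' = y - k * ?n"
  have kx: "k * ?n \<le> x" by (simp add: k_def)
  have x: "x = x' + k * ?n" using kx by (simp add: x'_def)
  have x': "x mod ?n = x'" by (simp add: x'_def k_def minus_div_mult_eq_mod)
  have y: "y = y' + k * ?n" using assms(1) kx by (simp add: y'_def)
  have y': "y mod ?n = y' mod ?n" by (subst y) simp
  have "{x..y} = (\<lambda>i. i + k * ?n) ` {x'..y'}"
    by (subst x, subst y) simp
  then have "(\<lambda>i. i mod ?n) ` {x..y} = (\<lambda>i. i mod ?n) ` {x'..y'}" by (simp only: image_image) simp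
  also have "\<dots> = arc P x' (y' mod ?n)"
  proof (rule base[symmetric])
    show "x' < ?n" using n x' mod_less_divisor[of ?n x] by simp
    show "x' \<le> y'" "y' < x' + ?n" using assms kx by (auto simp: x'_def y'_def)
  qed
  also have "\<dots> = arc P (x mod ?n) (y mod ?n)" by (simp only: x' y')
  finally show ?thesis by simp
qed

definition stp :: "bool list \<Rightarrow> (nat \<Rightarrow> nat) \<Rightarrow> nat \<Rightarrow> int" where
  "stp P w i = (if P ! i then - 1 else int (w i))"

abbreviation load :: "bool list \<Rightarrow> (nat \<Rightarrow> nat) \<Rightarrow> nat \<Rightarrow> int" where
  "load P w \<equiv> psum (stp P w) (length P)"

lemma finite_NE [simp]: "finite (NE P)" and finite_EE [simp]: "finite (EE P)"
  by (simp_all add: NE_def EE_def)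

lemma sum_edges_split:
  fixes f :: "nat \<Rightarrow> 'a::comm_monoid_add"
  assumes "A \<subseteq> {..<length P}"
  shows "sum f A = sum f (A \<inter> EE P) + sum f (A \<inter> NE P)"
proof -
  have "A = (A \<inter> EE P) \<union> (A \<inter> NE P)" using assms by (auto simp: EE_def NE_def)
  moreover have "finite A" using assms finite_subset by blast
  ultimately show ?thesis
    by (metis (no_types, lifting) sum.union_disjoint finite_Int disjoint_iff EE_def NE_def IntE mem_Collect_eq)
qed

lemma sum_stp:
  assumes "A \<subseteq> {..<length P}"
  shows "sum (stp P w) A = int (\<Sum>x\<in>A \<inter> EE P. w x) - int (card (A \<inter> NE P))"
proof -
  have "sum (stp P w) (A \<inter> EE P) = int (\<Sum>x\<in>A \<inter> EE P. w x)"
    by (auto simp: stp_def EE_def intro: sum.cong)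
  moreover have "sum (stp P w) (A \<inter> NE P) = (\<Sum>x\<in>A \<inter> NE P. - 1)"
    by (rule sum.cong) (auto simp: stp_def NE_def)
  ultimately show ?thesis using sum_edges_split[OF assms, of "stp P w"] by simp
qed

text \<open>The drift per turn. Its sign separates the light case, total horizontal weight at most
  \<open>card (NE P)\<close>, from the heavy one.\<close>

lemma load_period:
  "load P w (t + length P) = load P w t + (int (\<Sum>x\<in>EE P. w x) - int (card (NE P)))"
proof -
  have "{..<length P} \<inter> EE P = EE P" "{..<length P} \<inter> NE P = NE P"
    by (auto simp: EE_def NE_def)
  then show ?thesis using sum_stp[of "{..<length P}" P w]
    by (simp add: psum_add_period)
qed

text \<open>By this, the arc from \<open>x\<close> to \<open>y\<close> is balanced exactly when the
  load after \<open>y\<close> equals the load before \<open>x\<close>.\<close>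

lemma load_arc:
  assumes "x \<le> y" "y < x + length P"
  defines "A \<equiv> arc P (x mod length P) (y mod length P)"
  shows "load P w (Suc y) - load P w x = int (\<Sum>i\<in>A \<inter> EE P. w i) - int (card (A \<inter> NE P))"
proof -
  have n: "length P > 0" using assms by auto
  have A: "A = (\<lambda>i. i mod length P) ` {x..y}" unfolding A_def by (rule arc_mod_image[OF assms(1,2)])
  have "load P w (Suc y) - load P w x = (\<Sum>i\<in>{x..y}. stp P w (i mod length P))"
    using psum_diff[of x "Suc y" "stp P w" "length P"] assms by (simp add: atLeastLessThanSuc_atLeastAtMost)
  also have "\<dots> = sum (stp P w) A"
    unfolding A by (subst sum.reindex[OF inj_on_mod[OF assms(2)]]) simp
  also have "\<dots> = int (\<Sum>i\<in>A \<inter> EE P. w i) - int (card (A \<inter> NE P))"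
    by (rule sum_stp) (use n in \<open>auto simp: A\<close>)
  finally show ?thesis .
qed

lemma load_Suc_N: "P ! (t mod length P) \<Longrightarrow> load P w (Suc t) = load P w t - 1"
  by (simp add: psum_Suc stp_def)

lemma load_Suc_E: "\<not> P ! (t mod length P) \<Longrightarrow> load P w (Suc t) = load P w t + int (w (t mod length P))"
  by (simp add: psum_Suc stp_def)

section \<open>The two alternatives of compatibility, and forward balance as a return of the
  load\<close>

definition fwd_bal :: "bool list \<Rightarrow> (nat \<Rightarrow> nat) \<Rightarrow> nat \<Rightarrow> nat \<Rightarrow> bool" where
  "fwd_bal P w u v \<longleftrightarrow> (\<exists>e\<in>arc P u v. e \<in> NE P - {v} \<and>
     card (arc P u e \<inter> NE P) = (\<Sum>x\<in>arc P u e \<inter> EE P. w x))"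

definition bwd_bal :: "bool list \<Rightarrow> (nat \<Rightarrow> nat) \<Rightarrow> nat \<Rightarrow> nat \<Rightarrow> bool" where
  "bwd_bal P w u v \<longleftrightarrow> (\<exists>e\<in>arc P u v. e \<in> EE P - {u} \<and>
     card (arc P e v \<inter> EE P) = (\<Sum>x\<in>arc P e v \<inter> NE P. w x))"

lemma compatible_iff:
  "compatible P w \<longleftrightarrow> (\<forall>u\<in>EE P. \<forall>v\<in>NE P. 0 < w u \<longrightarrow> 0 < w v \<longrightarrow> fwd_bal P w u v \<or> bwd_bal P w u v)"
  unfolding compatible_def fwd_bal_def bwd_bal_def by (auto simp: bex_disj_distrib)

text \<open>The load rises at \<open>U\<close> and descends only in unit steps, so its first time at
  or below the starting level is at that very level and follows a north edge, the required
  \<open>e\<close>. The bound \<open>t \<le> V\<close>, rather than \<open>Suc V\<close>, encodes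
  that \<open>e\<close> differs from the endpoint.\<close>

lemma fwd_bal_iff_load:
  assumes "U < V" "V < U + length P"
    and u: "\<not> P ! (U mod length P)" "0 < w (U mod length P)"
  shows "fwd_bal P w (U mod length P) (V mod length P) \<longleftrightarrow>
           (\<exists>t. U < t \<and> t \<le> V \<and> load P w t \<le> load P w U)"
proof
  let ?n = "length P"
  assume "fwd_bal P w (U mod ?n) (V mod ?n)"
  then obtain e where e: "e \<in> arc P (U mod ?n) (V mod ?n)" "e \<noteq> V mod ?n"
    "card (arc P (U mod ?n) e \<inter> NE P) = (\<Sum>x\<in>arc P (U mod ?n) e \<inter> EE P. w x)"
    unfolding fwd_bal_def by blast
  from e(1) obtain y where y: "U \<le> y" "y \<le> V" "e = y mod ?n"
    using arc_mod_image[of U V P] assms by auto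
  have "load P w (Suc y) - load P w U = 0"
    using load_arc[of U y P w] e y assms by simp
  moreover have "y < V" using y e by (metis nat_less_le)
  ultimately show "\<exists>t. U < t \<and> t \<le> V \<and> load P w t \<le> load P w U"
    using y by (intro exI[of _ "Suc y"]) auto
next
  let ?n = "length P"
  let ?Q = "\<lambda>t. U < t \<and> t \<le> V \<and> load P w t \<le> load P w U"
  assume "\<exists>t. ?Q t"
  then obtain t where t: "?Q t" and least: "\<And>s. s < t \<Longrightarrow> \<not> ?Q s"
    using exists_least_iff[of ?Q] by blast
  have "load P w (Suc U) > load P w U" using u by (simp add: load_Suc_E)
  then have "t \<noteq> Suc U" using t by auto
  then obtain y where y: "t = Suc y" "U < y" using t by (cases t) auto
  then have ly: "load P w y > load P w U" using least[of y] t by auto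
  have N: "P ! (y mod ?n)" using t y ly load_Suc_E[of P y w] by fastforce
  then have "load P w (Suc y) = load P w U" using ly t y by (simp add: load_Suc_N)
  then have bal: "card (arc P (U mod ?n) (y mod ?n) \<inter> NE P) = (\<Sum>x\<in>arc P (U mod ?n) (y mod ?n) \<inter> EE P. w x)"
    using load_arc[of U y P w] y t assms by (simp del: of_nat_sum)
  have "?n > 0" using assms by auto
  then have "y mod ?n \<in> NE P" using N by (simp add: NE_def)
  moreover have "y mod ?n \<noteq> V mod ?n"
    using inj_onD[OF inj_on_mod[OF assms(2)], of y V] y t by auto
  moreover have "y mod ?n \<in> arc P (U mod ?n) (V mod ?n)"
    using arc_mod_image[of U V P] assms y t by auto
  ultimately show "fwd_bal P w (U mod ?n) (V mod ?n)"
    using bal unfolding fwd_bal_def by blast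
qed

section \<open>Shadows of horizontal gradings\<close>

text \<open>For such a \<open>v\<close> the first alternative of compatibility fails against some
  \<open>u\<close>, so a positive value at \<open>v\<close> must rely on the second. Only horizontal
  values enter.\<close>

definition shaded :: "bool list \<Rightarrow> (nat \<Rightarrow> nat) \<Rightarrow> nat \<Rightarrow> bool" where
  "shaded P w v \<longleftrightarrow> (\<exists>u\<in>EE P. 0 < w u \<and> \<not> fwd_bal P w u v)"

text \<open>Assuming \<open>n \<le> t\<close> leaves a full period of past before \<open>t\<close>;
  for this reason statements that look back are made at times from \<open>length P\<close>
  on.\<close>

lemma ex_lift_below:
  assumes "u < n" "n \<le> (t::nat)"
  obtains U where "U \<le> t" "t < U + n" "U mod n = u"
proof -
  define k where "k = t div n"
  have k: "t = k * n + t mod n" by (simp add: k_def)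
  have "k > 0" using assms by (simp add: k_def div_greater_zero_iff)
  then obtain j where j: "k = Suc j" by (cases k) auto
  have r: "t mod n < n" using assms by simp
  show ?thesis
  proof (cases "u \<le> t mod n")
    case True
    have m: "(k * n + u) mod n = u" using assms by simp
    have "k * n + u \<le> t" "t < k * n + u + n" using k True r by linarith+
    then show ?thesis using that m by blast
  next
    case False
    have m: "(j * n + u) mod n = u" using assms by simp
    have "t = j * n + n + t mod n" using k j by simp
    then have "j * n + u \<le> t" "t < j * n + u + n" using False assms r by linarith+
    then show ?thesis using that m by blast
  qed
qed

lemma ex_lift_above:
  assumes "u < (n::nat)"
  obtains U where "t \<le> U" "U < t + n" "U mod n = u"
proof -
  have "n \<le> t + n" by simp
  then obtain U where "U \<le> t + n" "t + n < U + n" "U mod n = u"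
    using ex_lift_below[OF assms] by blast
  moreover have "U \<noteq> t + n \<or> t mod n = u" using calculation by auto
  ultimately show ?thesis using that[of U] that[of t] assms by (cases "U = t + n") auto
qed

lemma not_shaded_iff_load:
  assumes t: "length P \<le> t" and n: "0 < length P" and N: "P ! (t mod length P)"
  shows "\<not> shaded P w (t mod length P) \<longleftrightarrow>
           (\<forall>s. s \<le> t \<longrightarrow> t < s + length P \<longrightarrow> load P w (Suc t) < load P w s)"
proof
  let ?n = "length P"
  assume ns: "\<not> shaded P w (t mod ?n)"
  show "\<forall>s. s \<le> t \<longrightarrow> t < s + ?n \<longrightarrow> load P w (Suc t) < load P w s"
  proof (rule ccontr)
    let ?Q = "\<lambda>s. s \<le> t \<and> t < s + ?n \<and> load P w s \<le> load P w (Suc t)"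
    assume "\<not> (\<forall>s. s \<le> t \<longrightarrow> t < s + ?n \<longrightarrow> load P w (Suc t) < load P w s)"
    then have ex: "\<exists>s. ?Q s" by (meson not_less)
    \<comment> \<open>Because \<open>s\<close> is the latest such time, the load stays strictly
      above its level up to \<open>t\<close>. So the step at \<open>s\<close> is an east edge of
      positive value, and it shades the edge at \<open>t\<close>.\<close>
    define s where "s = (GREATEST s. ?Q s)"
    have s: "?Q s" unfolding s_def by (rule GreatestI_ex_nat[OF ex, of t]) auto
    have gr: "y \<le> s" if "?Q y" for y unfolding s_def by (rule Greatest_le_nat[of ?Q y t]) (use that in auto)
    have "s \<noteq> t" using s N by (auto simp: load_Suc_N)
    then have st: "s < t" using s by simp
    have above: "load P w y > load P w s" if "s < y" "y \<le> t" for y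
      using gr[of y] that s by fastforce
    from above[of "Suc s"] have E: "\<not> P ! (s mod ?n)" and pos: "0 < w (s mod ?n)"
      using st load_Suc_N[of P s w] load_Suc_E[of P s w] by (fastforce, fastforce)
    have "\<not> fwd_bal P w (s mod ?n) (t mod ?n)"
      using fwd_bal_iff_load[of s t P w] st s E pos above by fastforce
    moreover have "s mod ?n \<in> EE P" using E n by (simp add: EE_def)
    ultimately show False using ns pos unfolding shaded_def by blast
  qed
next
  let ?n = "length P"
  assume rec: "\<forall>s. s \<le> t \<longrightarrow> t < s + ?n \<longrightarrow> load P w (Suc t) < load P w s"
  have "fwd_bal P w u (t mod ?n)" if u: "u \<in> EE P" "0 < w u" for u
  proof -
    obtain U where U: "U \<le> t" "t < U + ?n" "U mod ?n = u"
      using ex_lift_below[of u ?n t] t u by (auto simp: EE_def)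
    have "U \<noteq> t" using U u N by (auto simp: EE_def)
    moreover have "load P w t \<le> load P w U" using rec[rule_format, OF U(1,2)] N by (simp add: load_Suc_N)
    ultimately show ?thesis using fwd_bal_iff_load[of U t P w] U u by (auto simp: EE_def)
  qed
  then show "\<not> shaded P w (t mod ?n)" unfolding shaded_def by blast
qed

lemma sum_over_N_window:
  "(\<Sum>i\<in>{c..<c+length P}. if P ! (i mod length P) then f (i mod length P) else 0) = (\<Sum>i\<in>NE P. f i :: int)"
proof -
  have "(\<Sum>i\<in>{c..<c+length P}. if P ! (i mod length P) then f (i mod length P) else 0) =
        (\<Sum>i<length P. if P ! i then f i else 0)"
    using window_sum[of "\<lambda>i. if P ! i then f i else 0"] by simp
  also have "\<dots> = (\<Sum>i\<in>NE P. f i)"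
    by (rule sum.mono_neutral_cong_right) (auto simp: NE_def)
  finally show ?thesis .
qed

text \<open>Running minima of the load: the times outside every excursion above an earlier value. In
  the light case the load does not grow from turn to turn, so comparing with the whole past amounts
  to comparing with the last period.\<close>

definition outside :: "bool list \<Rightarrow> (nat \<Rightarrow> nat) \<Rightarrow> nat \<Rightarrow> bool" where
  "outside P w t \<longleftrightarrow> (\<forall>s\<le>t. load P w t \<le> load P w s)"

context
  fixes P :: "bool list" and w :: "nat \<Rightarrow> nat"
  assumes light: "(\<Sum>x\<in>EE P. w x) \<le> card (NE P)" and nonempty: "0 < length P"
begin

lemma load_period_decr: "load P w (s + length P) \<le> load P w s"
  using light by (simp add: load_period del: of_nat_sum)

lemma load_periods_decr: "load P w (s + k * length P) \<le> load P w s"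
proof (induction k)
  case (Suc k)
  have "s + Suc k * length P = (s + k * length P) + length P" by simp
  then show ?case using Suc load_period_decr[of "s + k * length P"] by (metis order_trans)
qed simp

lemma ex_recent_load_le:
  assumes "s \<le> t"
  obtains s' where "s' \<le> t" "t < s' + length P" "load P w s' \<le> load P w s"
proof
  let ?k = "(t - s) div length P"
  have "?k * length P \<le> t - s" by simp
  then show "s + ?k * length P \<le> t" using assms by linarith
  have "t - s < ?k * length P + length P"
    using nonempty by (metis add.commute dividend_less_div_times)
  then show "t < s + ?k * length P + length P" using assms by linarith
  show "load P w (s + ?k * length P) \<le> load P w s" by (rule load_periods_decr)
qed

lemma shaded_iff_not_outside:
  assumes "length P \<le> t" "P ! (t mod length P)"
  shows "shaded P w (t mod length P) \<longleftrightarrow> \<not> outside P w t"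
proof -
  have "(\<forall>s. s \<le> t \<longrightarrow> t < s + length P \<longrightarrow> load P w (Suc t) < load P w s) \<longleftrightarrow>
        (\<forall>s\<le>t. load P w (Suc t) < load P w s)" (is "?L \<longleftrightarrow> ?R")
  proof
    assume L: ?L
    show ?R
    proof (intro allI impI)
      fix s assume "s \<le> t"
      then obtain s' where "s' \<le> t" "t < s' + length P" "load P w s' \<le> load P w s"
        by (rule ex_recent_load_le)
      then show "load P w (Suc t) < load P w s" using L by fastforce
    qed
  qed simp
  also have "\<dots> \<longleftrightarrow> outside P w t"
    unfolding outside_def using assms(2) by (auto simp: load_Suc_N)
  finally show ?thesis using not_shaded_iff_load[OF assms(1) nonempty assms(2), of w] by blast
qed

text \<open>A minimiser of the load over a window of one period. A full turn from there both begins
  and ends at a running minimum, as counting along the turn requires.\<close>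

lemma ex_cut:
  obtains c where "length P \<le> c" "outside P w c" "outside P w (c + length P)"
proof -
  let ?n = "length P"
  obtain c where c: "c \<in> {?n..2*?n}" "\<And>y. y \<in> {?n..2*?n} \<Longrightarrow> load P w c \<le> load P w y"
    using ex_min_if_finite[of "load P w ` {?n..2*?n}"] by (auto simp: not_less)
  have o: "outside P w c" unfolding outside_def
  proof (intro allI impI)
    fix s assume "s \<le> c"
    show "load P w c \<le> load P w s"
    proof (cases "?n \<le> s")
      case True
      then show ?thesis using c \<open>s \<le> c\<close> by auto
    next
      case False
      then have "load P w c \<le> load P w (s + ?n)" by (intro c(2)) auto
      then show ?thesis using load_period_decr[of s] by linarith
    qed
  qed
  have "outside P w (c + ?n)" unfolding outside_def
  proof (intro allI impI)
    fix s assume s: "s \<le> c + ?n"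
    have shift: "load P w (c + ?n) \<le> load P w (y + ?n)" if "y \<le> c" for y
      using o that unfolding outside_def by (simp add: load_period)
    show "load P w (c + ?n) \<le> load P w s"
    proof (cases "?n \<le> s")
      case True
      then show ?thesis using shift[of "s - ?n"] s by simp
    next
      case False
      then show ?thesis using shift[of s] load_period_decr[of s] c(1) by auto
    qed
  qed
  then show ?thesis using that o c by auto
qed

text \<open>Each unshaded north edge is a new strict minimum of the load, and the minimum drops by
  exactly one there.\<close>

lemma card_unshaded_light:
  "int (card {v \<in> NE P. \<not> shaded P w v}) = int (card (NE P)) - int (\<Sum>x\<in>EE P. w x)"
proof -
  let ?n = "length P"
  obtain c where c: "?n \<le> c" "outside P w c" "outside P w (c + ?n)" by (rule ex_cut)
  define g :: "nat \<Rightarrow> int" where "g = (\<lambda>i. if shaded P w i then 0 else 1)"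
  define Z where "Z t = load P w c - (\<Sum>i\<in>{c..<t}. if P ! (i mod ?n) then g (i mod ?n) else 0)" for t
  \<comment> \<open>The invariant says that \<open>Z t\<close> is the minimum of the load over the
    whole past of \<open>t\<close>. At both ends of the turn this is the load itself, so the drift
    counts the unshaded edges.\<close>
  have inv: "c \<le> t \<Longrightarrow> (\<forall>s\<le>t. Z t \<le> load P w s) \<and> (\<exists>s\<le>t. load P w s = Z t)" for t
  proof (induction t rule: dec_induct)
    case base
    then show ?case using c(2) unfolding outside_def Z_def by auto
  next
    case (step t)
    have ZS: "Z (Suc t) = Z t - (if P ! (t mod ?n) then g (t mod ?n) else 0)"
      using step(1) by (simp add: Z_def)
    have lt: "?n \<le> t" using step c by simp
    show ?case
    proof (cases "P ! (t mod ?n) \<and> outside P w t")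
      case True
      then have "g (t mod ?n) = 1" using shaded_iff_not_outside[OF lt] by (simp add: g_def)
      then have Z1: "Z (Suc t) = Z t - 1" using ZS True by simp
      have "Z t = load P w t" using step(3) True unfolding outside_def
        by (metis order_antisym order_refl)
      then have "load P w (Suc t) = Z (Suc t)" using Z1 True by (simp add: load_Suc_N)
      moreover have "Z (Suc t) \<le> load P w s" if "s \<le> Suc t" for s
      proof (cases "s = Suc t")
        case False
        then have "Z t \<le> load P w s" using that step(3) by simp
        then show ?thesis using Z1 by simp
      qed (use calculation in simp)
      ultimately show ?thesis by blast
    next
      case False
      then have Z1: "Z (Suc t) = Z t" using ZS shaded_iff_not_outside[OF lt] by (auto simp: g_def)
      have "Z t \<le> load P w (Suc t)"
      proof (cases "P ! (t mod ?n)")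
        case True
        then obtain s where "s \<le> t" "load P w s < load P w t"
          using False by (auto simp: outside_def not_le)
        then show ?thesis using step(3) True by (fastforce simp: load_Suc_N)
      next
        case False
        then show ?thesis using step(3) by (fastforce simp: load_Suc_E)
      qed
      then have "Z (Suc t) \<le> load P w s" if "s \<le> Suc t" for s
        using that step(3) Z1 by (cases "s = Suc t") auto
      then show ?thesis using step(3) Z1 by (metis le_Suc_eq)
    qed
  qed
  have "Z (c + ?n) = load P w (c + ?n)"
    using inv[of "c + ?n"] c(3) unfolding outside_def by (metis le_add1 order_antisym order_refl)
  moreover have "Z (c + ?n) = load P w c - (\<Sum>i\<in>NE P. g i)"
    by (simp add: Z_def sum_over_N_window)
  moreover have "(\<Sum>i\<in>NE P. g i) = int (card {v \<in> NE P. \<not> shaded P w v})"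
  proof -
    have "(\<Sum>i\<in>NE P. g i) = (\<Sum>i\<in>{v \<in> NE P. \<not> shaded P w v}. 1)"
      by (rule sum.mono_neutral_cong_right) (auto simp: g_def)
    then show ?thesis by simp
  qed
  ultimately show ?thesis by (simp add: load_period del: of_nat_sum)
qed

end

text \<open>In the heavy case the load after a north edge exceeds its value one turn earlier, so
  every north edge is shaded, in agreement with truncated subtraction.\<close>

lemma card_unshaded:
  "card {v \<in> NE P. \<not> shaded P w v} = card (NE P) - (\<Sum>x\<in>EE P. w x)"
proof (cases "length P = 0")
  case True
  then show ?thesis by (simp add: NE_def)
next
  case False
  show ?thesis
  proof (cases "(\<Sum>x\<in>EE P. w x) \<le> card (NE P)")
    case True
    then show ?thesis using card_unshaded_light[OF True] False by (simp del: of_nat_sum)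
  next
    case heavy: False
    have "shaded P w v" if v: "v \<in> NE P" for v
    proof (rule ccontr)
      assume "\<not> shaded P w v"
      then have "load P w (Suc (v + length P)) < load P w (Suc v)"
        using not_shaded_iff_load[of P "v + length P" w] v False by (auto simp: NE_def)
      then show False using load_period[of P w "Suc v"] heavy by (simp del: of_nat_sum)
    qed
    then show ?thesis using heavy by (simp add: card_eq_0_iff)
  qed
qed

section \<open>Reversal of paths\<close>

text \<open>This reversal exchanges the two alternatives of compatibility, so facts on backward
  balance are inherited from forward balance.\<close>

definition dual :: "bool list \<Rightarrow> bool list" where
  "dual P = rev (map Not P)"

text \<open>The value 0 off the path makes the result a member of \<open>gradings\<close>
  again.\<close>

definition mirror :: "bool list \<Rightarrow> (nat \<Rightarrow> nat) \<Rightarrow> nat \<Rightarrow> nat" where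
  "mirror P w i = (if i < length P then w (length P - Suc i) else 0)"

abbreviation opp :: "bool list \<Rightarrow> nat \<Rightarrow> nat" where
  "opp P i \<equiv> length P - Suc i"

lemma length_dual [simp]: "length (dual P) = length P"
  by (simp add: dual_def)

lemma dual_dual [simp]: "dual (dual P) = P"
  by (simp add: dual_def rev_map comp_def)

lemma nth_dual: "i < length P \<Longrightarrow> dual P ! i \<longleftrightarrow> \<not> P ! opp P i"
  by (simp add: dual_def rev_nth)

lemma inj_on_opp: "A \<subseteq> {..<length P} \<Longrightarrow> inj_on (opp P) A"
  by (rule inj_on_inverseI[where g = "opp P"]) auto

lemma NE_subset: "NE P \<subseteq> {..<length P}" and EE_subset: "EE P \<subseteq> {..<length P}"
  by (auto simp: NE_def EE_def)

lemma opp_image_iff: "A \<subseteq> {..<length P} \<Longrightarrow> i < length P \<Longrightarrow> i \<in> opp P ` A \<longleftrightarrow> opp P i \<in> A"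
  by (force simp: image_iff)

lemma NE_dual: "NE (dual P) = opp P ` EE P"
proof (rule set_eqI)
  fix i show "i \<in> NE (dual P) \<longleftrightarrow> i \<in> opp P ` EE P"
  proof (cases "i < length P")
    case True
    then show ?thesis using EE_subset[of P]
      by (auto simp: opp_image_iff nth_dual NE_def EE_def)
  next
    case False
    then show ?thesis by (auto simp: NE_def EE_def)
  qed
qed

lemma EE_dual: "EE (dual P) = opp P ` NE P"
proof (rule set_eqI)
  fix i show "i \<in> EE (dual P) \<longleftrightarrow> i \<in> opp P ` NE P"
  proof (cases "i < length P")
    case True
    then show ?thesis using NE_subset[of P]
      by (auto simp: opp_image_iff nth_dual NE_def EE_def)
  next
    case False
    then show ?thesis by (auto simp: NE_def EE_def)
  qed
qed

lemma card_NE_dual [simp]: "card (NE (dual P)) = card (EE P)"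
  by (simp add: NE_dual card_image inj_on_opp EE_subset)

lemma card_EE_dual [simp]: "card (EE (dual P)) = card (NE P)"
  by (simp add: EE_dual card_image inj_on_opp NE_subset)

lemma arc_subset: "f < length P \<Longrightarrow> arc P e f \<subseteq> {..<length P}"
  by (auto simp: arc_def)

lemma arc_dual:
  assumes "e < length P" "f < length P"
  shows "arc (dual P) (opp P f) (opp P e) = opp P ` arc P e f"
proof (rule set_eqI)
  fix i
  show "i \<in> arc (dual P) (opp P f) (opp P e) \<longleftrightarrow> i \<in> opp P ` arc P e f"
  proof (cases "i < length P")
    case True
    then have "i \<in> opp P ` arc P e f \<longleftrightarrow> opp P i \<in> arc P e f"
      using opp_image_iff arc_subset[OF assms(2)] by blast
    then show ?thesis using assms True by (auto simp: arc_def)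
  next
    case False
    then show ?thesis using assms by (auto simp: arc_def split: if_splits)
  qed
qed

lemma sum_mirror:
  assumes "A \<subseteq> {..<length P}"
  shows "sum (mirror P w) (opp P ` A) = sum w A"
  unfolding sum.reindex[OF inj_on_opp[OF assms]]
  by (rule sum.cong) (use assms in \<open>auto simp: mirror_def\<close>)

lemma sum_EE_dual: "sum (mirror P w) (EE (dual P)) = sum w (NE P)"
  by (simp add: EE_dual sum_mirror NE_subset)

lemma sum_NE_dual: "sum (mirror P w) (NE (dual P)) = sum w (EE P)"
  by (simp add: NE_dual sum_mirror EE_subset)

lemma opp_image_Int:
  "A \<subseteq> {..<length P} \<Longrightarrow> B \<subseteq> {..<length P} \<Longrightarrow> opp P ` A \<inter> opp P ` B = opp P ` (A \<inter> B)"
  using inj_on_image_Int[OF inj_on_opp[OF order_refl, of P], of A B] by simp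

lemma fwd_bal_dual:
  assumes "u < length P" "v < length P"
  shows "fwd_bal (dual P) (mirror P w) (opp P v) (opp P u) \<longleftrightarrow> bwd_bal P w u v"
proof -
  have "opp P e \<in> NE (dual P) - {opp P u} \<and>
        card (arc (dual P) (opp P v) (opp P e) \<inter> NE (dual P)) =
          sum (mirror P w) (arc (dual P) (opp P v) (opp P e) \<inter> EE (dual P)) \<longleftrightarrow>
        e \<in> EE P - {u} \<and> card (arc P e v \<inter> EE P) = sum w (arc P e v \<inter> NE P)"
    if e: "e \<in> arc P u v" for e
  proof -
    have en: "e < length P" using e arc_subset[OF assms(2)] by auto
    have a: "arc P e v \<subseteq> {..<length P}" by (rule arc_subset[OF assms(2)])
    have "opp P e = opp P u \<longleftrightarrow> e = u" using en assms by auto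
    moreover have "opp P e \<in> NE (dual P) \<longleftrightarrow> e \<in> EE P"
      using en by (auto simp: NE_def EE_def nth_dual)
    moreover have "card (arc (dual P) (opp P v) (opp P e) \<inter> NE (dual P)) = card (arc P e v \<inter> EE P)"
      unfolding arc_dual[OF en assms(2)] NE_dual opp_image_Int[OF a EE_subset]
      by (rule card_image[OF inj_on_opp]) (use a in auto)
    moreover have "sum (mirror P w) (arc (dual P) (opp P v) (opp P e) \<inter> EE (dual P)) = sum w (arc P e v \<inter> NE P)"
      unfolding arc_dual[OF en assms(2)] EE_dual opp_image_Int[OF a NE_subset]
      by (rule sum_mirror) (use a in auto)
    ultimately show ?thesis by simp
  qed
  then show ?thesis
    unfolding fwd_bal_def bwd_bal_def arc_dual[OF assms] by (simp only: bex_simps) blast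
qed

lemma mirror_mirror: "w \<in> gradings P \<Longrightarrow> mirror P (mirror P w) = w"
  by (auto simp: mirror_def gradings_def fun_eq_iff)

lemma mirror_grading: "mirror P w \<in> gradings P"
  by (auto simp: mirror_def gradings_def)

lemma gradings_dual: "gradings (dual P) = gradings P"
  by (simp add: gradings_def)

lemma mirror_dual: "mirror (dual P) = mirror P"
  by (simp add: mirror_def fun_eq_iff)

lemma mirror_opp: "i < length P \<Longrightarrow> mirror P w (opp P i) = w i"
  by (simp add: mirror_def)

lemma bwd_bal_dual:
  assumes "u < length P" "v < length P" "w \<in> gradings P"
  shows "bwd_bal (dual P) (mirror P w) (opp P v) (opp P u) \<longleftrightarrow> fwd_bal P w u v"
  using fwd_bal_dual[of "opp P v" "dual P" "opp P u" "mirror P w"] assms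
  by (simp add: mirror_dual mirror_mirror)

lemma compatible_dual:
  assumes "w \<in> gradings P"
  shows "compatible (dual P) (mirror P w) \<longleftrightarrow> compatible P w"
proof -
  have "compatible (dual P) (mirror P w) \<longleftrightarrow>
    (\<forall>v\<in>NE P. \<forall>u\<in>EE P. 0 < w v \<longrightarrow> 0 < w u \<longrightarrow> bwd_bal P w u v \<or> fwd_bal P w u v)"
    unfolding compatible_iff NE_dual EE_dual ball_simps
    by (intro ball_cong refl)
       (auto simp: NE_def EE_def mirror_opp fwd_bal_dual bwd_bal_dual[OF _ _ assms])
  also have "\<dots> \<longleftrightarrow> compatible P w" unfolding compatible_iff by blast
  finally show ?thesis .
qed

text \<open>This is \<open>shaded\<close> seen through the reversal, see \<open>shaded_dual\<close>;
  its count is inherited from \<open>card_unshaded\<close>.\<close>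

definition bshaded :: "bool list \<Rightarrow> (nat \<Rightarrow> nat) \<Rightarrow> nat \<Rightarrow> bool" where
  "bshaded P w u \<longleftrightarrow> (\<exists>v\<in>NE P. 0 < w v \<and> \<not> bwd_bal P w u v)"

lemma shaded_dual:
  assumes "u < length P"
  shows "shaded (dual P) (mirror P w) (opp P u) \<longleftrightarrow> bshaded P w u"
  unfolding shaded_def bshaded_def EE_dual bex_simps
  by (intro bex_cong refl) (use assms in \<open>auto simp: NE_def mirror_opp fwd_bal_dual\<close>)

lemma card_unbshaded:
  "card {u \<in> EE P. \<not> bshaded P w u} = card (EE P) - sum w (NE P)"
proof -
  have "{v \<in> NE (dual P). \<not> shaded (dual P) (mirror P w) v} = opp P ` {u \<in> EE P. \<not> bshaded P w u}"
    using shaded_dual[of _ P w] EE_subset[of P] unfolding NE_dual by blast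
  moreover have "card (opp P ` {u \<in> EE P. \<not> bshaded P w u}) = card {u \<in> EE P. \<not> bshaded P w u}"
    by (rule card_image[OF inj_on_opp]) (auto simp: EE_def)
  ultimately show ?thesis
    using card_unshaded[of "dual P" "mirror P w"] by (simp add: sum_EE_dual)
qed

section \<open>Tight gradings, and the height of a path below its diagonal\<close>

definition tight :: "bool list \<Rightarrow> (nat \<Rightarrow> nat) \<Rightarrow> bool" where
  "tight P w \<longleftrightarrow> compatible P w \<and> (\<forall>v\<in>NE P. 0 < w v \<longrightarrow> shaded P w v)"

text \<open>A witness for the shorter arc lies at or after \<open>U\<close>; the strict
  \<open>t < U\<close> keeps it distinct from the new starting edge.\<close>

lemma bwd_bal_mono:
  assumes "t < U" "U \<le> V" "V < t + length P"
    and "bwd_bal P w (U mod length P) (V mod length P)"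
  shows "bwd_bal P w (t mod length P) (V mod length P)"
proof -
  let ?n = "length P"
  obtain e where e: "e \<in> arc P (U mod ?n) (V mod ?n)" "e \<in> EE P"
    "card (arc P e (V mod ?n) \<inter> EE P) = sum w (arc P e (V mod ?n) \<inter> NE P)"
    using assms(4) unfolding bwd_bal_def by blast
  have "arc P (U mod ?n) (V mod ?n) = (\<lambda>i. i mod ?n) ` {U..V}"
    by (rule arc_mod_image) (use assms in auto)
  then obtain y where y: "U \<le> y" "y \<le> V" "e = y mod ?n" using e by auto
  have "arc P (t mod ?n) (V mod ?n) = (\<lambda>i. i mod ?n) ` {t..V}"
    by (rule arc_mod_image) (use assms in auto)
  then have "e \<in> arc P (t mod ?n) (V mod ?n)" using y assms by auto
  moreover have "e \<noteq> t mod ?n"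
    using inj_onD[OF inj_on_mod[OF assms(3)], of y t] y assms by auto
  ultimately show ?thesis using e unfolding bwd_bal_def by blast
qed

text \<open>A positive \<open>v\<close> that backward shades the edge is, by tightness, shaded by
  some \<open>u\<close>, and compatibility makes \<open>u\<close> and \<open>v\<close> backward
  balanced. If \<open>u\<close> were met at or after \<open>t\<close>, its witness would serve the
  edge at \<open>t\<close> too. So \<open>u\<close> comes earlier and opens an excursion that still
  lasts at \<open>t\<close>.\<close>

lemma bshaded_imp_not_outside:
  assumes "tight P w" "length P \<le> t" "t mod length P \<in> EE P" "bshaded P w (t mod length P)"
  shows "\<not> outside P w t"
proof -
  let ?n = "length P"
  obtain v where v: "v \<in> NE P" "0 < w v" "\<not> bwd_bal P w (t mod ?n) v"
    using assms(4) unfolding bshaded_def by blast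
  obtain V where V: "t \<le> V" "V < t + ?n" "V mod ?n = v"
    using ex_lift_above[of v ?n t] v by (auto simp: NE_def)
  obtain u where u: "u \<in> EE P" "0 < w u" "\<not> fwd_bal P w u v"
    using assms(1) v unfolding tight_def shaded_def by blast
  then have bw: "bwd_bal P w u v" using assms(1) v unfolding tight_def compatible_iff by blast
  have "?n \<le> V" using assms(2) V by simp
  then obtain U where U: "U \<le> V" "V < U + ?n" "U mod ?n = u"
    using ex_lift_below[of u ?n V] u by (auto simp: EE_def)
  have "U \<noteq> V" using U V u v by (auto simp: EE_def NE_def)
  then have above: "load P w U < load P w x" if "U < x" "x \<le> V" for x
    using fwd_bal_iff_load[of U V P w] U V u that by (fastforce simp: EE_def)
  have "\<not> t < U"
    using bwd_bal_mono[of t U V P w] U V bw v(3) by auto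
  moreover have "U \<noteq> t" using bw v(3) U by auto
  ultimately have "U < t" by simp
  then show ?thesis using above[of t] V unfolding outside_def by (meson less_imp_le not_le)
qed

text \<open>After \<open>x\<close> east and \<open>y\<close> north edges the partial sum is
  \<open>x * card (NE P) - y * card (EE P)\<close>, the cross product that measures how far the path
  is below the diagonal.\<close>

definition rise :: "bool list \<Rightarrow> nat \<Rightarrow> int" where
  "rise P i = (if P ! i then - int (card (EE P)) else int (card (NE P)))"

abbreviation height :: "bool list \<Rightarrow> nat \<Rightarrow> int" where
  "height P \<equiv> psum (rise P) (length P)"

text \<open>Weakly below the diagonal and as high as possible: a height below
  \<open>card (EE P)\<close> before an east edge means that a north edge there would cross the
  diagonal. The bound after a north edge is the image of this one under reversal, which makes the
  condition self-dual.\<close>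

definition hugging :: "bool list \<Rightarrow> bool" where
  "hugging P \<longleftrightarrow> (\<forall>t<length P. 0 \<le> height P t \<and>
     (if P ! t then height P (Suc t) < int (card (NE P)) else height P t < int (card (EE P))))"

lemma sum_rise: "(\<Sum>i<length P. rise P i) = 0"
proof -
  have *: "{..<length P} \<inter> EE P = EE P" "{..<length P} \<inter> NE P = NE P"
    by (auto simp: EE_def NE_def)
  have "sum (rise P) (EE P) = (\<Sum>i\<in>EE P. int (card (NE P)))"
    by (rule sum.cong) (auto simp: rise_def EE_def)
  moreover have "sum (rise P) (NE P) = (\<Sum>i\<in>NE P. - int (card (EE P)))"
    by (rule sum.cong) (auto simp: rise_def NE_def)
  ultimately show ?thesis
    using sum_edges_split[of "{..<length P}" P "rise P"] by (simp add: *)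
qed

lemma height_mod: "height P t = height P (t mod length P)"
  using psum_add_periods[of "rise P" "length P" "t mod length P" "t div length P"]
  by (simp add: sum_rise)

lemma hugging_nonneg: "hugging P \<Longrightarrow> 0 < length P \<Longrightarrow> 0 \<le> height P t"
  by (subst height_mod) (simp add: hugging_def)

lemma hugging_N:
  assumes "hugging P" "0 < length P" "P ! (t mod length P)"
  shows "height P (Suc t) < int (card (NE P))"
proof -
  have "height P (Suc t) = height P (Suc (t mod length P))"
    using height_mod[of P t] by (simp add: psum_Suc)
  then show ?thesis using assms by (simp add: hugging_def)
qed

section \<open>The slope of tight gradings\<close>

lemma card_shaded: "int (card {v \<in> NE P. shaded P w v}) = min (int (card (NE P))) (int (sum w (EE P)))"
proof -
  have "NE P = {v \<in> NE P. shaded P w v} \<union> {v \<in> NE P. \<not> shaded P w v}" by auto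
  then have "card (NE P) = card {v \<in> NE P. shaded P w v} + card {v \<in> NE P. \<not> shaded P w v}"
    by (subst card_Un_disjoint[symmetric]) auto
  then show ?thesis using card_unshaded[of P w] by linarith
qed

lemma card_bshaded: "int (card {u \<in> EE P. bshaded P w u}) = min (int (card (EE P))) (int (sum w (NE P)))"
proof -
  have "EE P = {v \<in> EE P. bshaded P w v} \<union> {v \<in> EE P. \<not> bshaded P w v}" by auto
  then have "card (EE P) = card {v \<in> EE P. bshaded P w v} + card {v \<in> EE P. \<not> bshaded P w v}"
    by (subst card_Un_disjoint[symmetric]) auto
  then show ?thesis using card_unbshaded[of P w] by linarith
qed

text \<open>Cut the cyclic path at a global minimum of the load and follow it once around. The load
  decomposes it into excursions above the running minimum; all shaded north edges lie inside
  excursions, and so do all backward shaded east edges, which are never the first edge of an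
  excursion. Inside an excursion the count \<open>X\<close> is controlled by the height, and the
  height is below \<open>card (NE P)\<close> when an excursion ends.\<close>

lemma tight_slope_light:
  assumes "tight P w" "hugging P" and light: "sum w (EE P) \<le> card (NE P)"
    and pos: "0 < sum w (EE P)"
  shows "card (NE P) * card {u \<in> EE P. bshaded P w u} < card (EE P) * card {v \<in> NE P. shaded P w v}"
proof -
  let ?n = "length P" and ?a = "int (card (EE P))" and ?b = "int (card (NE P))"
  have n: "0 < ?n" using pos by (cases "length P") (auto simp: EE_def)
  obtain c where c: "?n \<le> c" "outside P w c" "outside P w (c + ?n)"
    by (rule ex_cut[OF light n])
  \<comment> \<open>Like \<open>rise\<close>, but counting shaded edges only; the total over a turn
    is the difference to be proved negative.\<close>
  define x where "x i = (if P ! i then (if shaded P w i then - ?a else 0)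
                         else if bshaded P w i then ?b else 0)" for i
  define X where "X t = (\<Sum>i\<in>{c..<t}. x (i mod ?n))" for t
  define seen where "seen t \<longleftrightarrow> (\<exists>i. c \<le> i \<and> i < t \<and> P ! (i mod ?n) \<and> shaded P w (i mod ?n))" for t
  \<comment> \<open>An excursion opens with an east edge of \<open>x\<close>-value 0 whose rise
    lifts the height to at least \<open>card (NE P)\<close>. Inside, \<open>x\<close> never exceeds
    \<open>rise\<close>, and at the closing north edge \<open>hugging_N\<close> makes
    \<open>X\<close> negative. \<open>seen\<close> carries this strictness to the end of the
    turn.\<close>
  have inv: "c \<le> t \<Longrightarrow> (outside P w t \<longrightarrow> X t \<le> 0 \<and> (seen t \<longrightarrow> X t < 0)) \<and>
      (\<not> outside P w t \<longrightarrow> X t \<le> height P t - ?b)" for t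
  proof (induction t rule: dec_induct)
    case base
    then show ?case using c(2) by (simp add: X_def seen_def)
  next
    case (step t)
    have lt: "?n \<le> t" using step c by simp
    have XS: "X (Suc t) = X t + x (t mod ?n)" using step(1) by (simp add: X_def)
    have HS: "height P (Suc t) = height P t + rise P (t mod ?n)" by (simp add: psum_Suc)
    have outI: "outside P w (Suc t) \<longleftrightarrow> (\<forall>s\<le>t. load P w (Suc t) \<le> load P w s)"
      unfolding outside_def by (auto simp: le_Suc_eq)
    have H0: "0 \<le> height P t" by (rule hugging_nonneg[OF assms(2) n])
    show ?case
    proof (cases "P ! (t mod ?n)")
      case N: True
      note sh = shaded_iff_not_outside[OF light n lt N]
      show ?thesis
      proof (cases "outside P w t")
        case True
        then have "outside P w (Suc t)" using N unfolding outI by (force simp: outside_def load_Suc_N)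
        moreover have "x (t mod ?n) = 0" using N sh True by (simp add: x_def)
        moreover have "seen (Suc t) \<longleftrightarrow> seen t" using sh True by (auto simp: seen_def less_Suc_eq)
        ultimately show ?thesis using step(3) True XS by simp
      next
        case False
        moreover have "x (t mod ?n) = - ?a" using N sh False by (simp add: x_def)
        moreover have "rise P (t mod ?n) = - ?a" using N by (simp add: rise_def)
        ultimately have "X (Suc t) \<le> height P (Suc t) - ?b"
          using step(3) XS HS by simp
        then show ?thesis using hugging_N[OF assms(2) n N] by simp
      qed
    next
      case E: False
      then have mem: "t mod ?n \<in> EE P" using n by (simp add: EE_def)
      have r: "rise P (t mod ?n) = ?b" using E by (simp add: rise_def)
      have seen: "seen (Suc t) \<longleftrightarrow> seen t" using E by (auto simp: seen_def less_Suc_eq)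
      show ?thesis
      proof (cases "outside P w t")
        case True
        then have "x (t mod ?n) = 0"
          using bshaded_imp_not_outside[OF assms(1) lt mem] E by (auto simp: x_def)
        then show ?thesis using step(3) True XS HS r H0 seen by simp
      next
        case False
        then obtain s where "s \<le> t" "load P w s < load P w t" by (auto simp: outside_def not_le)
        then have "\<not> outside P w (Suc t)"
          using E unfolding outI by (force simp: load_Suc_E)
        moreover have "x (t mod ?n) \<le> ?b" using E by (simp add: x_def)
        ultimately show ?thesis using step(3) False XS HS r by simp
      qed
    qed
  qed
  have "0 < int (card {v \<in> NE P. shaded P w v})" using card_shaded[of P w] light pos by linarith
  then obtain v where v: "v \<in> NE P" "shaded P w v" by (auto simp: card_gt_0_iff)
  obtain V where "c \<le> V" "V < c + ?n" "V mod ?n = v"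
    using ex_lift_above[of v ?n c] v by (auto simp: NE_def)
  then have "seen (c + ?n)" unfolding seen_def using v by (auto simp: NE_def)
  then have "X (c + ?n) < 0" using inv[of "c + ?n"] c(3) by simp
  moreover have "X (c + ?n) = sum x {..<?n}" unfolding X_def by (rule window_sum)
  moreover have "sum x {..<?n} = sum x (EE P) + sum x (NE P)"
    using sum_edges_split[of "{..<?n}" P x] EE_subset[of P] NE_subset[of P]
    by (simp add: Int_absorb1)
  moreover have "sum x (EE P) = (\<Sum>i\<in>{u \<in> EE P. bshaded P w u}. ?b)"
    by (rule sum.mono_neutral_cong_right) (auto simp: x_def EE_def)
  moreover have "sum x (NE P) = (\<Sum>i\<in>{v \<in> NE P. shaded P w v}. - ?a)"
    by (rule sum.mono_neutral_cong_right) (auto simp: x_def NE_def)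
  ultimately have "?b * int (card {u \<in> EE P. bshaded P w u}) < ?a * int (card {v \<in> NE P. shaded P w v})"
    by (simp add: algebra_simps)
  then show ?thesis by (simp flip: of_nat_mult)
qed

text \<open>With positive drift the load stays above its last minimum \<open>U\<close> of a period
  throughout the next turn, so the east edge there is forward balanced with no vertical edge.
  Compatibility then forces backward balance against every positive one.\<close>

lemma ex_unbshaded_heavy:
  assumes "tight P w" and heavy: "card (NE P) < sum w (EE P)"
  shows "\<exists>u\<in>EE P. \<not> bshaded P w u"
proof -
  let ?n = "length P"
  have n: "0 < ?n" using heavy by (cases "length P") (auto simp: EE_def)
  have incr: "load P w s < load P w (s + ?n)" for s
    using heavy by (simp add: load_period del: of_nat_sum)
  obtain U0 where U0: "U0 < ?n" "\<And>y. y < ?n \<Longrightarrow> load P w U0 \<le> load P w y"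
    using ex_min_if_finite[of "load P w ` {..<?n}"] n by (auto simp: not_less)
  let ?Q = "\<lambda>s. s < ?n \<and> load P w s = load P w U0"
  define U where "U = (GREATEST s. ?Q s)"
  have U: "?Q U" unfolding U_def by (rule GreatestI_nat[of ?Q U0 ?n]) (use U0 in auto)
  have last: "y \<le> U" if "?Q y" for y
    unfolding U_def by (rule Greatest_le_nat[of ?Q y ?n]) (use that in auto)
  have above: "load P w U < load P w y" if "U < y" "y \<le> U + ?n" for y
  proof (cases "y < ?n")
    case True
    then show ?thesis using last[of y] U U0(2)[of y] that by fastforce
  next
    case False
    then have "load P w (y - ?n) < load P w y" using incr[of "y - ?n"] by simp
    moreover have "y - ?n < ?n" using U that False by linarith
    then have "load P w U \<le> load P w (y - ?n)" using U U0(2)[of "y - ?n"] by simp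
    ultimately show ?thesis by simp
  qed
  have Um: "U mod ?n = U" using U by simp
  have "load P w U < load P w (Suc U)" using above[of "Suc U"] n by simp
  then have E: "\<not> P ! U" and pos: "0 < w U"
    using load_Suc_N[of P U w] load_Suc_E[of P U w] Um by (fastforce, fastforce)
  have "bwd_bal P w U v" if v: "v \<in> NE P" "0 < w v" for v
  proof -
    obtain V where V: "U \<le> V" "V < U + ?n" "V mod ?n = v"
      using ex_lift_above[of v ?n U] v by (auto simp: NE_def)
    have "U \<noteq> V" using V v E Um by (auto simp: NE_def)
    then have "\<not> fwd_bal P w U v"
      using fwd_bal_iff_load[of U V P w] V above E pos Um by fastforce
    then show ?thesis using assms(1) v E pos U unfolding tight_def compatible_iff
      by (auto simp: EE_def)
  qed
  then show ?thesis using E U unfolding bshaded_def by (auto simp: EE_def)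
qed

text \<open>In the light case \<open>tight_slope_light\<close> is the claim once the backward shaded
  edges number \<open>sum w (NE P)\<close>; the other possibility in \<open>card_bshaded\<close>,
  all of \<open>card (EE P)\<close>, would contradict lightness. In the heavy case an edge that is
  not backward shaded gives \<open>sum w (NE P) < card (EE P)\<close>, to be combined with
  \<open>card (NE P) < sum w (EE P)\<close>.\<close>

lemma tight_slope:
  assumes "tight P w" "hugging P" "sum w (NE P) \<noteq> 0 \<or> sum w (EE P) \<noteq> 0"
  shows "sum w (NE P) * card (NE P) < sum w (EE P) * card (EE P)"
proof (cases "sum w (EE P) = 0")
  case True
  then have "int (card {v \<in> NE P. shaded P w v}) = 0" using card_shaded[of P w] by simp
  then have "{v \<in> NE P. shaded P w v} = {}" by simp
  then have "w v = 0" if "v \<in> NE P" for v using assms(1) that unfolding tight_def by blast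
  then have "sum w (NE P) = 0" by simp
  then show ?thesis using assms(3) True by simp
next
  case q: False
  show ?thesis
  proof (cases "sum w (EE P) \<le> card (NE P)")
    case light: True
    let ?k = "card {u \<in> EE P. bshaded P w u}"
    have sh: "card {v \<in> NE P. shaded P w v} = sum w (EE P)" using card_shaded[of P w] light by linarith
    have lt: "card (NE P) * ?k < card (EE P) * sum w (EE P)"
      using tight_slope_light[OF assms(1,2) light] q sh by simp
    have "?k = sum w (NE P)"
    proof (rule ccontr)
      assume "?k \<noteq> sum w (NE P)"
      then have "?k = card (EE P)" using card_bshaded[of P w] by linarith
      then have "card (NE P) * card (EE P) < sum w (EE P) * card (EE P)" using lt by (simp add: mult.commute)
      then show False using light by simp
    qed
    then show ?thesis using lt by (simp add: mult.commute)
  next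
    case heavy: False
    then obtain u where u: "u \<in> EE P" "\<not> bshaded P w u"
      using ex_unbshaded_heavy[OF assms(1)] by auto
    then have "{u \<in> EE P. \<not> bshaded P w u} \<noteq> {}" by blast
    then have "0 < card {u \<in> EE P. \<not> bshaded P w u}" by (simp add: card_gt_0_iff)
    then have "sum w (NE P) < card (EE P)" using card_unbshaded[of P w] by simp
    then have "sum w (NE P) * card (NE P) \<le> card (EE P) * card (NE P)" by simp
    also have "\<dots> < card (EE P) * sum w (EE P)" using heavy \<open>sum w (NE P) < card (EE P)\<close> by simp
    finally show ?thesis by (simp add: mult.commute)
  qed
qed

lemma height_dual:
  assumes "t \<le> length P"
  shows "height (dual P) t = height P (length P - t)"
  using assms
proof (induction t)
  case 0
  have "height P (length P) = 0" using height_mod[of P "length P"] by simp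
  then show ?case by simp
next
  case (Suc t)
  then have t: "t < length P" by simp
  have "length P - t = Suc (opp P t)" using t by simp
  then have "height P (length P - t) = height P (opp P t) + rise P (opp P t)"
    using t by (simp add: psum_Suc)
  moreover have "rise (dual P) t = - rise P (opp P t)"
    using t by (simp add: rise_def nth_dual)
  ultimately show ?case using Suc t by (simp add: psum_Suc)
qed

lemma hugging_dual:
  assumes "hugging P"
  shows "hugging (dual P)"
  unfolding hugging_def
proof (intro allI impI conjI)
  fix t assume "t < length (dual P)"
  then have t: "t < length P" by simp
  show "0 \<le> height (dual P) t"
    using t hugging_nonneg[OF assms, of "length P - t"] height_dual[of t P] by (cases P) auto
  have r: "opp P t < length P" "Suc (opp P t) = length P - t" using t by auto
  have "if P ! opp P t then height P (length P - t) < int (card (NE P))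
        else height P (opp P t) < int (card (EE P))"
    using assms r unfolding hugging_def by auto
  then show "if dual P ! t then height (dual P) (Suc t) < int (card (NE (dual P)))
             else height (dual P) t < int (card (EE (dual P)))"
    using t height_dual[of t P] height_dual[of "Suc t" P] by (simp add: nth_dual)
qed

section \<open>Dyck paths are hugging\<close>

lemma length_path_aux [simp]: "length (path_aux a b x y r) = r"
  by (induction a b x y r rule: path_aux.induct) auto

lemma card_NE_Cons: "card (NE (z # P)) = (if z then 1 else 0) + card (NE P)"
proof -
  have "NE (z # P) = (if z then {0} else {}) \<union> Suc ` NE P"
  proof (rule set_eqI)
    fix i show "i \<in> NE (z # P) \<longleftrightarrow> i \<in> (if z then {0} else {}) \<union> Suc ` NE P"
      by (cases i) (auto simp: NE_def)
  qed
  then show ?thesis by (auto simp: card_image)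
qed

lemma card_EE_Cons: "card (EE (z # P)) = (if z then 0 else 1) + card (EE P)"
proof -
  have "EE (z # P) = (if z then {} else {0}) \<union> Suc ` EE P"
  proof (rule set_eqI)
    fix i show "i \<in> EE (z # P) \<longleftrightarrow> i \<in> (if z then {} else {0}) \<union> Suc ` EE P"
      by (cases i) (auto simp: EE_def)
  qed
  then show ?thesis by (auto simp: card_image)
qed

lemma card_path_aux:
  assumes "r = (a - x) + (b - y)" "x \<le> a" "y \<le> b"
  shows "card (NE (path_aux a b x y r)) = b - y \<and> card (EE (path_aux a b x y r)) = a - x"
  using assms
proof (induction a b x y r rule: path_aux.induct)
  case (1 a b x y)
  then show ?case by (simp add: NE_def EE_def)
next
  case (2 a b x y r)
  show ?case
  proof (cases "y < b \<and> (y + 1) * a \<le> x * b")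
    case True
    then have P: "path_aux a b x y (Suc r) = True # path_aux a b x (y + 1) r" by simp
    have "card (NE (path_aux a b x (y + 1) r)) = b - (y + 1) \<and> card (EE (path_aux a b x (y + 1) r)) = a - x"
      by (rule 2(1)[OF True]) (use 2(3-5) True in auto)
    then show ?thesis unfolding P using True by (auto simp: card_NE_Cons card_EE_Cons)
  next
    case False
    \<comment> \<open>At \<open>x = a\<close> with edges left, the greedy rule would go
      north.\<close>
    have "x < a"
    proof (rule ccontr)
      assume "\<not> x < a"
      then have xa: "x = a" using 2 by simp
      then have "y < b" using 2(3) by simp
      then have "(y + 1) * a \<le> a * b" by (metis Suc_eq_plus1 Suc_leI mult.commute mult_le_mono1)
      then show False using False \<open>y < b\<close> xa by simp
    qed
    have P: "path_aux a b x y (Suc r) = False # path_aux a b (x + 1) y r" using False by auto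
    have "card (NE (path_aux a b (x + 1) y r)) = b - y \<and> card (EE (path_aux a b (x + 1) y r)) = a - (x + 1)"
      by (rule 2(2)[OF False]) (use 2(3-5) \<open>x < a\<close> in auto)
    then show ?thesis unfolding P using \<open>x < a\<close> by (simp add: card_NE_Cons card_EE_Cons)
  qed
qed

lemma card_dyck_path: "card (NE (dyck_path a b)) = b" "card (EE (dyck_path a b)) = a"
  using card_path_aux[of "a + b" a 0 b 0] by (simp_all add: dyck_path_def)

text \<open>\<open>rise\<close> with the endpoint as a parameter: the induction passes to tails of
  the path, whose own edge counts differ.\<close>

definition slope_rise :: "nat \<Rightarrow> nat \<Rightarrow> bool \<Rightarrow> int" where
  "slope_rise a b z = (if z then - int a else int b)"

text \<open>The bound \<open>h < int a + int b\<close> is the invariant of the greedy rule. A north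
  step needs \<open>h \<ge> a\<close> and leaves \<open>h - a < b\<close>; an east step is taken
  only when \<open>h < a\<close> and leaves \<open>h + b < a + b\<close>.\<close>

lemma path_aux_height:
  assumes "h = int x * int b - int y * int a" "0 \<le> h" "h < int a + int b"
    and "r = (a - x) + (b - y)" "x \<le> a" "y \<le> b" "t < r"
  defines "Q \<equiv> path_aux a b x y r"
  shows "0 \<le> h + (\<Sum>i<t. slope_rise a b (Q ! i)) \<and>
     (if Q ! t then h + (\<Sum>i<Suc t. slope_rise a b (Q ! i)) < int b
      else h + (\<Sum>i<t. slope_rise a b (Q ! i)) < int a)"
  using assms(1-7) unfolding Q_def
proof (induction a b x y r arbitrary: t h rule: path_aux.induct)
  case (1 a b x y)
  then show ?case by simp
next
  case (2 a b x y r)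
  have sumS: "(\<Sum>i<Suc k. slope_rise a b ((z # Q) ! i)) = slope_rise a b z + (\<Sum>i<k. slope_rise a b (Q ! i))" for z Q k
    by (subst sum.lessThan_Suc_shift) simp
  have rise: "slope_rise a b True = - int a" "slope_rise a b False = int b"
    by (simp_all add: slope_rise_def)
  show ?case
  proof (cases "y < b \<and> (y + 1) * a \<le> x * b")
    case True
    let ?h = "h - int a"
    have "int ((y + 1) * a) \<le> int (x * b)" using True by (simp only: of_nat_le_iff)
    then have h: "?h = int x * int b - int (y + 1) * int a" "0 \<le> ?h" "?h < int b"
      using 2(3-5) by (auto simp: algebra_simps)
    show ?thesis
    proof (cases t)
      case 0
      then show ?thesis using True 2(4) h by (simp add: slope_rise_def)
    next
      case (Suc k)
      have "r = (a - x) + (b - (y + 1))" "k < r" using 2 Suc True by auto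
      then have IH: "0 \<le> ?h + (\<Sum>i<k. slope_rise a b (path_aux a b x (y+1) r ! i)) \<and>
     (if path_aux a b x (y+1) r ! k then ?h + (\<Sum>i<Suc k. slope_rise a b (path_aux a b x (y+1) r ! i)) < int b
      else ?h + (\<Sum>i<k. slope_rise a b (path_aux a b x (y+1) r ! i)) < int a)"
        using 2(1)[OF True, of ?h k] h 2(7) True by auto
      have P: "path_aux a b x y (Suc r) = True # path_aux a b x (y+1) r" using True by simp
      have e: "h + (- int a + z) = ?h + z" for z by simp
      show ?thesis unfolding P Suc sumS rise nth_Cons_Suc e by (rule IH)
    qed
  next
    case False
    let ?h = "h + int b"
    have xa: "x < a"
    proof (rule ccontr)
      assume "\<not> x < a"
      then have xa: "x = a" using 2 by simp
      then have "y < b" using 2(6,9) by simp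
      then have "(y + 1) * a \<le> a * b" by (metis Suc_eq_plus1 Suc_leI mult.commute mult_le_mono1)
      then show False using False \<open>y < b\<close> xa by simp
    qed
    have ha: "h < int a"
    proof (cases "y < b")
      case True
      then have "int (x * b) < int ((y + 1) * a)" using False by (simp only: of_nat_less_iff) simp
      then show ?thesis using 2(3) by (simp add: algebra_simps)
    next
      case yb: False
      then have "h = (int x - int a) * int b" using 2 by (simp add: algebra_simps)
      then have "h \<le> 0" using xa by (simp add: mult_nonpos_nonneg)
      then show ?thesis using xa by simp
    qed
    have h: "?h = int (x + 1) * int b - int y * int a" "0 \<le> ?h" "?h < int a + int b"
      using 2(3-5) ha by (auto simp: algebra_simps)
    show ?thesis
    proof (cases t)
      case 0
      then show ?thesis using False 2(4) ha by auto
    next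
      case (Suc k)
      have "r = (a - (x + 1)) + (b - y)" "k < r" using 2 Suc xa by auto
      then have IH: "0 \<le> ?h + (\<Sum>i<k. slope_rise a b (path_aux a b (x+1) y r ! i)) \<and>
     (if path_aux a b (x+1) y r ! k then ?h + (\<Sum>i<Suc k. slope_rise a b (path_aux a b (x+1) y r ! i)) < int b
      else ?h + (\<Sum>i<k. slope_rise a b (path_aux a b (x+1) y r ! i)) < int a)"
        using 2(2)[OF False, of ?h k] h 2(8) xa by auto
      have P: "path_aux a b x y (Suc r) = False # path_aux a b (x+1) y r" using False by auto
      have e: "h + (int b + z) = ?h + z" for z by simp
      show ?thesis unfolding P Suc sumS rise nth_Cons_Suc e by (rule IH)
    qed
  qed
qed

lemma hugging_dyck_path: "hugging (dyck_path a b)"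
  unfolding hugging_def
proof (intro allI impI)
  fix t assume t: "t < length (dyck_path a b)"
  let ?P = "dyck_path a b"
  have n: "length ?P = a + b" by (simp add: dyck_path_def)
  have H: "height ?P s = (\<Sum>i<s. slope_rise a b (?P ! i))" if "s \<le> length ?P" for s
    unfolding psum_def
    by (rule sum.cong) (use that in \<open>auto simp: rise_def slope_rise_def card_dyck_path\<close>)
  have "height ?P t = (\<Sum>i<t. slope_rise a b (?P ! i))"
    "height ?P (Suc t) = (\<Sum>i<Suc t. slope_rise a b (?P ! i))"
    using H t by (simp_all only: Suc_leI less_imp_le)
  moreover have "0 \<le> 0 + (\<Sum>i<t. slope_rise a b (?P ! i)) \<and>
     (if ?P ! t then 0 + (\<Sum>i<Suc t. slope_rise a b (?P ! i)) < int b
      else 0 + (\<Sum>i<t. slope_rise a b (?P ! i)) < int a)"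
    unfolding dyck_path_def by (rule path_aux_height) (use t n in auto)
  ultimately show "0 \<le> height ?P t \<and> (if ?P ! t then height ?P (Suc t) < int (card (NE ?P))
          else height ?P t < int (card (EE ?P)))"
    by (simp only: card_dyck_path add_0) blast
qed

section \<open>Summing over compatible gradings\<close>

text \<open>The weights \<open>f\<close> (vertical) and \<open>g\<close> (horizontal) are arbitrary,
  so that reversal, which exchanges them, stays within the same family of sums.\<close>

definition gwt :: "(nat \<Rightarrow> 'a::comm_ring_1) \<Rightarrow> (nat \<Rightarrow> 'a) \<Rightarrow> bool list \<Rightarrow> (nat \<Rightarrow> nat) \<Rightarrow> 'a" where
  "gwt f g P w = (\<Prod>i\<in>EE P. g (w i)) * (\<Prod>j\<in>NE P. f (w j))"

definition graded :: "bool list \<Rightarrow> (nat \<Rightarrow> nat) set \<Rightarrow> nat \<Rightarrow> nat \<Rightarrow> (nat \<Rightarrow> nat) set" where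
  "graded P W p q = {w \<in> gradings P. w \<in> W \<and> sum w (NE P) = p \<and> sum w (EE P) = q}"

definition grsum :: "(nat \<Rightarrow> 'a::comm_ring_1) \<Rightarrow> (nat \<Rightarrow> 'a) \<Rightarrow> bool list \<Rightarrow> (nat \<Rightarrow> nat) set \<Rightarrow> nat \<Rightarrow> nat \<Rightarrow> 'a" where
  "grsum f g P W p q = (\<Sum>w\<in>graded P W p q. gwt f g P w)"

lemma finite_graded: "finite (graded P W p q)"
proof (rule finite_subset)
  show "finite {w. \<forall>i. (i \<in> {..<length P} \<longrightarrow> w i \<in> {..p + q}) \<and> (i \<notin> {..<length P} \<longrightarrow> w i = 0)}"
    by (rule finite_set_of_finite_funs) auto
  have "w i \<le> p + q" if "sum w (NE P) = p" "sum w (EE P) = q" "i < length P" for w :: "nat \<Rightarrow> nat" and i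
  proof (cases "P ! i")
    case True
    then have "w i \<le> sum w (NE P)" by (intro member_le_sum) (use that in \<open>auto simp: NE_def\<close>)
    then show ?thesis using that by simp
  next
    case False
    then have "w i \<le> sum w (EE P)" by (intro member_le_sum) (use that in \<open>auto simp: EE_def\<close>)
    then show ?thesis using that by simp
  qed
  then show "graded P W p q \<subseteq>
    {w. \<forall>i. (i \<in> {..<length P} \<longrightarrow> w i \<in> {..p + q}) \<and> (i \<notin> {..<length P} \<longrightarrow> w i = 0)}"
    by (auto simp: graded_def gradings_def)
qed

lemma prod_mirror:
  assumes "A \<subseteq> {..<length P}"
  shows "(\<Prod>i\<in>opp P ` A. h (mirror P w i)) = (\<Prod>i\<in>A. h (w i) :: 'a::comm_ring_1)"
  unfolding prod.reindex[OF inj_on_opp[OF assms]]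
  by (rule prod.cong) (use assms in \<open>auto simp: mirror_def\<close>)

lemma grsum_dual:
  assumes "\<And>w. w \<in> gradings P \<Longrightarrow> mirror P w \<in> W' \<longleftrightarrow> w \<in> W"
  shows "grsum g f (dual P) W' q p = grsum f g P W p q"
proof -
  have "grsum f g P W p q = grsum g f (dual P) W' q p"
    unfolding grsum_def
  proof (rule sum.reindex_bij_witness[where i = "mirror P" and j = "mirror P"])
    fix w assume w: "w \<in> graded P W p q"
    show "mirror P (mirror P w) = w" using w by (simp add: mirror_mirror graded_def)
    show "mirror P w \<in> graded (dual P) W' q p"
      using w assms by (simp add: graded_def gradings_dual mirror_grading sum_NE_dual sum_EE_dual)
    show "gwt g f (dual P) (mirror P w) = gwt f g P w"
      by (simp add: gwt_def EE_dual NE_dual prod_mirror EE_subset NE_subset mult.commute)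
  next
    fix w assume w: "w \<in> graded (dual P) W' q p"
    then have g: "w \<in> gradings P" by (simp add: graded_def gradings_dual)
    show "mirror P (mirror P w) = w" using g by (rule mirror_mirror)
    have "mirror P w \<in> W" using assms[OF mirror_grading, of w] w g by (simp add: mirror_mirror graded_def)
    then show "mirror P w \<in> graded P W p q"
      using w sum_NE_dual[of "dual P" w] sum_EE_dual[of "dual P" w]
      by (simp add: graded_def mirror_grading mirror_dual)
  qed
  then show ?thesis by simp
qed

section \<open>Generating series of freely chosen values\<close>

definition comps :: "nat set \<Rightarrow> nat \<Rightarrow> (nat \<Rightarrow> nat) set" where
  "comps A k = {c. (\<forall>i. i \<notin> A \<longrightarrow> c i = 0) \<and> sum c A = k}"

lemma finite_comps: "finite A \<Longrightarrow> finite (comps A k)"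
proof (rule finite_subset)
  assume A: "finite A"
  show "finite {w. \<forall>i. (i \<in> A \<longrightarrow> w i \<in> {..k}) \<and> (i \<notin> A \<longrightarrow> w i = 0)}"
    by (rule finite_set_of_finite_funs) (use A in auto)
  show "comps A k \<subseteq> {w. \<forall>i. (i \<in> A \<longrightarrow> w i \<in> {..k}) \<and> (i \<notin> A \<longrightarrow> w i = 0)}"
    using A by (auto simp: comps_def intro: member_le_sum)
qed

lemma sum_comps:
  fixes f :: "nat \<Rightarrow> 'a::comm_ring_1"
  assumes "finite A"
  shows "(\<Sum>c\<in>comps A k. \<Prod>i\<in>A. f (c i)) = fps_nth (Abs_fps f ^ card A) k"
  using assms
proof (induction A arbitrary: k rule: finite_induct)
  case empty
  have "comps {} k = (if k = 0 then {\<lambda>_. 0} else {})" by (auto simp: comps_def fun_eq_iff)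
  then show ?case by simp
next
  case (insert x A)
  have "(\<Sum>c\<in>comps (insert x A) k. \<Prod>i\<in>insert x A. f (c i)) =
        (\<Sum>(j, c)\<in>(SIGMA j:{0..k}. comps A (k - j)). f j * (\<Prod>i\<in>A. f (c i)))"
  proof (rule sum.reindex_bij_witness[where j = "\<lambda>c. (c x, c(x := 0))" and i = "\<lambda>(j, c). c(x := j)"])
    fix c assume c: "c \<in> comps (insert x A) k"
    have s: "sum (c(x := 0)) A = sum c A" by (rule sum.cong) (use insert in auto)
    have pr: "(\<Prod>i\<in>A. f ((c(x := 0)) i)) = (\<Prod>i\<in>A. f (c i))" by (rule prod.cong) (use insert in auto)
    show "(c x, c(x := 0)) \<in> (SIGMA j:{0..k}. comps A (k - j))"
      using c insert s by (auto simp: comps_def)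
    show "(case (c x, c(x := 0)) of (j, c) \<Rightarrow> f j * (\<Prod>i\<in>A. f (c i))) = (\<Prod>i\<in>insert x A. f (c i))"
      using insert pr by simp
    show "(case (c x, c(x := 0)) of (j, c) \<Rightarrow> c(x := j)) = c" by simp
  next
    fix jc assume jc: "jc \<in> (SIGMA j:{0..k}. comps A (k - j))"
    obtain j c where [simp]: "jc = (j, c)" by (cases jc)
    have c: "j \<le> k" "c \<in> comps A (k - j)" using jc by auto
    have s: "sum (c(x := j)) A = sum c A" by (rule sum.cong) (use insert in auto)
    show "(case jc of (j, c) \<Rightarrow> c(x := j)) \<in> comps (insert x A) k"
      using c insert s by (auto simp: comps_def)
    have "c x = 0" using c insert by (auto simp: comps_def)
    then show "((case jc of (j, c) \<Rightarrow> c(x := j)) x, (case jc of (j, c) \<Rightarrow> c(x := j))(x := 0)) = jc"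
      by (auto simp: fun_eq_iff)
  qed
  also have "\<dots> = (\<Sum>j=0..k. \<Sum>c\<in>comps A (k - j). f j * (\<Prod>i\<in>A. f (c i)))"
    by (subst sum.Sigma) (use insert finite_comps in auto)
  also have "\<dots> = (\<Sum>j=0..k. f j * fps_nth (Abs_fps f ^ card A) (k - j))"
    by (simp add: insert.IH flip: sum_distrib_left)
  also have "\<dots> = fps_nth (Abs_fps f ^ card (insert x A)) k"
    using insert by (simp add: fps_mult_nth)
  finally show ?case .
qed

section \<open>Compatibility and the values on unshaded vertical edges\<close>

lemma fwd_bal_cong:
  assumes "\<And>i. i \<in> EE P \<Longrightarrow> w i = w' i"
  shows "fwd_bal P w u v = fwd_bal P w' u v"
proof -
  have "sum w (A \<inter> EE P) = sum w' (A \<inter> EE P)" for A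
    by (rule sum.cong) (use assms in auto)
  then show ?thesis unfolding fwd_bal_def by simp
qed

lemma shaded_cong:
  assumes "\<And>i. i \<in> EE P \<Longrightarrow> w i = w' i"
  shows "shaded P w v = shaded P w' v"
proof -
  have "fwd_bal P w u v = fwd_bal P w' u v" for u by (rule fwd_bal_cong) (rule assms)
  then show ?thesis unfolding shaded_def using assms by auto
qed

lemma arc_mono_left: "x \<in> arc P u v \<Longrightarrow> u < length P \<Longrightarrow> v < length P \<Longrightarrow> arc P x v \<subseteq> arc P u v"
  by (auto simp: arc_def split: if_splits)

lemma arc_mono_right: "x \<in> arc P u v \<Longrightarrow> u < length P \<Longrightarrow> v < length P \<Longrightarrow> arc P u x \<subseteq> arc P u v"
  by (auto simp: arc_def split: if_splits)

lemma arc_antisym: "x \<in> arc P u v \<Longrightarrow> v \<in> arc P u x \<Longrightarrow> u < length P \<Longrightarrow> v < length P \<Longrightarrow> x = v"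
  by (auto simp: arc_def split: if_splits)

lemma fwd_bal_mono:
  assumes "fwd_bal P w u x" "x \<in> arc P u v" "u < length P" "v < length P"
  shows "fwd_bal P w u v"
proof -
  obtain e where e: "e \<in> arc P u x" "e \<in> NE P - {x}"
    "card (arc P u e \<inter> NE P) = sum w (arc P u e \<inter> EE P)"
    using assms(1) unfolding fwd_bal_def by blast
  have "e \<noteq> v" using e arc_antisym[OF assms(2) _ assms(3,4)] by auto
  moreover have "e \<in> arc P u v" using e arc_mono_right[OF assms(2-4)] by auto
  ultimately show ?thesis using e unfolding fwd_bal_def by blast
qed

text \<open>If forward balance fails from \<open>u\<close> to \<open>v\<close>, it fails from
  \<open>u\<close> to every edge in between by \<open>fwd_bal_mono\<close>, so all vertical edges on
  the arc are shaded. Hence backward balance of \<open>u\<close> and \<open>v\<close> reads values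
  on shaded edges only.\<close>

lemma compatible_transfer:
  assumes E: "\<And>i. i \<in> EE P \<Longrightarrow> w i = w' i"
    and N: "\<And>v. v \<in> NE P \<Longrightarrow> shaded P w v \<Longrightarrow> w v = w' v"
    and comp: "compatible P w"
  shows "compatible P w'"
  unfolding compatible_iff
proof (intro ballI impI)
  fix u v assume u: "u \<in> EE P" "0 < w' u" and v: "v \<in> NE P" "0 < w' v"
  have n: "u < length P" "v < length P" using u v by (auto simp: EE_def NE_def)
  have wu: "0 < w u" using u E by simp
  show "fwd_bal P w' u v \<or> bwd_bal P w' u v"
  proof (cases "fwd_bal P w u v")
    case True
    then show ?thesis using fwd_bal_cong[of P w w' u v] E by blast
  next
    case False
    then have "shaded P w v" using u wu unfolding shaded_def by blast
    then have "0 < w v" using N v by simp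
    then have "bwd_bal P w u v" using comp u v wu False unfolding compatible_iff by blast
    then obtain e where e: "e \<in> arc P u v" "e \<in> EE P - {u}"
      "card (arc P e v \<inter> EE P) = sum w (arc P e v \<inter> NE P)"
      unfolding bwd_bal_def by blast
    have "w x = w' x" if "x \<in> arc P e v \<inter> NE P" for x
    proof -
      have "x \<in> arc P u v" using that arc_mono_left[OF e(1) n] by blast
      then have "\<not> fwd_bal P w u x" using False fwd_bal_mono n by blast
      then show ?thesis using N[of x] that u wu unfolding shaded_def by blast
    qed
    then have "sum w (arc P e v \<inter> NE P) = sum w' (arc P e v \<inter> NE P)" by (rule sum.cong[OF HOL.refl])
    then show ?thesis using e unfolding bwd_bal_def by auto
  qed
qed

section \<open>Splitting a compatible grading into a tight core and free slack\<close>

abbreviation unshaded :: "bool list \<Rightarrow> (nat \<Rightarrow> nat) \<Rightarrow> nat set" where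
  "unshaded P w \<equiv> {v \<in> NE P. \<not> shaded P w v}"

lemma EE_NE_disjoint: "i \<in> EE P \<Longrightarrow> i \<notin> NE P"
  by (simp add: EE_def NE_def)

definition core :: "bool list \<Rightarrow> (nat \<Rightarrow> nat) \<Rightarrow> nat \<Rightarrow> nat" where
  "core P w i = (if i \<in> unshaded P w then 0 else w i)"

definition slack :: "bool list \<Rightarrow> (nat \<Rightarrow> nat) \<Rightarrow> nat \<Rightarrow> nat" where
  "slack P w i = (if i \<in> unshaded P w then w i else 0)"

lemma core_plus_slack: "core P w i + slack P w i = w i"
  by (simp add: core_def slack_def)

lemma unshaded_core: "unshaded P (core P w) = unshaded P w"
proof -
  have "i \<in> EE P \<Longrightarrow> w i = core P w i" for i using EE_NE_disjoint[of i P] by (simp add: core_def)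
  then show ?thesis using shaded_cong[of P w "core P w"] by blast
qed

lemma tight_core:
  assumes comp: "compatible P w"
  shows "tight P (core P w)"
proof -
  have E: "i \<in> EE P \<Longrightarrow> w i = core P w i" for i using EE_NE_disjoint[of i P] by (simp add: core_def)
  have sh: "shaded P (core P w) v = shaded P w v" for v using shaded_cong[of P w "core P w"] E by blast
  have "compatible P (core P w)"
    by (rule compatible_transfer[OF _ _ comp]) (use E in \<open>auto simp: core_def\<close>)
  then show ?thesis unfolding tight_def sh by (auto simp: core_def)
qed

lemma slack_zero: "i \<notin> unshaded P (core P w) \<Longrightarrow> slack P w i = 0"
  unfolding unshaded_core by (auto simp: slack_def)

lemma tight_zero: "tight P t \<Longrightarrow> i \<in> unshaded P t \<Longrightarrow> t i = 0"
  unfolding tight_def by blast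

context
  fixes P :: "bool list" and t c :: "nat \<Rightarrow> nat"
  assumes t: "tight P t" and c: "\<And>i. i \<notin> unshaded P t \<Longrightarrow> c i = 0"
begin

lemma tight_plus_E: "i \<in> EE P \<Longrightarrow> t i + c i = t i"
  using c[of i] EE_NE_disjoint[of i P] by simp

lemma compatible_tight_plus: "compatible P (\<lambda>i. t i + c i)"
  by (rule compatible_transfer[of P t]) (use tight_plus_E c t in \<open>auto simp: tight_def\<close>)

lemma unshaded_tight_plus: "unshaded P (\<lambda>i. t i + c i) = unshaded P t"
  using shaded_cong[of P t "\<lambda>i. t i + c i"] tight_plus_E by simp

lemma core_tight_plus: "core P (\<lambda>i. t i + c i) = t"
proof
  fix i show "core P (\<lambda>i. t i + c i) i = t i"
    unfolding core_def unshaded_tight_plus using c[of i] tight_zero[OF t, of i]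
    by (cases "i \<in> unshaded P t") auto
qed

lemma slack_tight_plus: "slack P (\<lambda>i. t i + c i) = c"
proof
  fix i show "slack P (\<lambda>i. t i + c i) i = c i"
    unfolding slack_def unshaded_tight_plus using c[of i] tight_zero[OF t, of i]
    by (cases "i \<in> unshaded P t") auto
qed

lemma sum_NE_tight_plus: "(\<Sum>i\<in>NE P. t i + c i) = sum t (NE P) + sum c (unshaded P t)"
proof -
  have "sum c (NE P) = sum c (unshaded P t)"
    by (rule sum.mono_neutral_right) (use c in auto)
  then show ?thesis by (simp add: sum.distrib)
qed

lemma sum_EE_tight_plus: "(\<Sum>i\<in>EE P. t i + c i) = sum t (EE P)"
  using tight_plus_E by simp

lemma gwt_tight_plus:
  assumes f0: "f 0 = (1 :: 'a::comm_ring_1)"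
  shows "gwt f g P (\<lambda>i. t i + c i) = gwt f g P t * (\<Prod>i\<in>unshaded P t. f (c i))"
proof -
  have "(\<Prod>j\<in>NE P. f (t j + c j)) = (\<Prod>j\<in>NE P. f (t j) * f (c j))"
  proof (rule prod.cong)
    fix j assume "j \<in> NE P"
    show "f (t j + c j) = f (t j) * f (c j)"
      using tight_zero[OF t, of j] c[of j] f0 by (cases "j \<in> unshaded P t") simp_all
  qed simp
  also have "\<dots> = (\<Prod>j\<in>NE P. f (t j)) * (\<Prod>j\<in>NE P. f (c j))" by (rule prod.distrib)
  also have "(\<Prod>j\<in>NE P. f (c j)) = (\<Prod>j\<in>unshaded P t. f (c j))"
    by (rule prod.mono_neutral_right) (use c f0 in auto)
  finally show ?thesis using tight_plus_E by (simp add: gwt_def mult.assoc)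
qed

end

lemma sum_Sigma3:
  assumes "finite A" "\<And>a. a \<in> A \<Longrightarrow> finite (B a)" "\<And>a b. a \<in> A \<Longrightarrow> b \<in> B a \<Longrightarrow> finite (C a b)"
  shows "(\<Sum>(a, b, c)\<in>(SIGMA a:A. SIGMA b:B a. C a b). h a b c) = (\<Sum>a\<in>A. \<Sum>b\<in>B a. \<Sum>c\<in>C a b. h a b c)"
proof -
  have "(\<Sum>(a, b, c)\<in>(SIGMA a:A. SIGMA b:B a. C a b). h a b c) =
    (\<Sum>a\<in>A. \<Sum>bc\<in>(SIGMA b:B a. C a b). h a (fst bc) (snd bc))"
    by (subst sum.Sigma) (use assms in \<open>auto simp: split_def\<close>)
  also have "\<dots> = (\<Sum>a\<in>A. \<Sum>b\<in>B a. \<Sum>c\<in>C a b. h a b c)"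
    by (rule sum.cong[OF HOL.refl], subst sum.Sigma) (use assms in \<open>auto simp: split_def\<close>)
  finally show ?thesis .
qed

text \<open>Splitting into \<open>core\<close> and \<open>slack\<close> is inverted by adding any
  values on the unshaded edges to a tight grading. By \<open>card_unshaded\<close> the number of
  these edges is the same for all cores of horizontal weight \<open>q\<close>, so the slack
  contributes a common power of the series.\<close>

lemma grsum_compatible:
  fixes f g :: "nat \<Rightarrow> 'a::comm_ring_1"
  assumes f0: "f 0 = 1"
  shows "grsum f g P (Collect (compatible P)) p q =
    (\<Sum>k=0..p. grsum f g P (Collect (tight P)) k q * fps_nth (Abs_fps f ^ (card (NE P) - q)) (p - k))"
proof -
  define T where "T k = graded P (Collect (tight P)) k q" for k
  \<comment> \<open>\<open>k\<close> is determined by the core; carrying it along arranges the sum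
    by the vertical weight of the core.\<close>
  define S where "S = (SIGMA k:{0..p}. SIGMA t:T k. comps (unshaded P t) (p - k))"
  define m :: "nat \<times> (nat \<Rightarrow> nat) \<times> (nat \<Rightarrow> nat) \<Rightarrow> nat \<Rightarrow> nat" where "m = (\<lambda>(k, t, c) i. t i + c i)"
  have "(\<Sum>w\<in>graded P (Collect (compatible P)) p q. gwt f g P w) =
        (\<Sum>(k, t, c)\<in>S. gwt f g P t * (\<Prod>i\<in>unshaded P t. f (c i)))"
  proof (rule sum.reindex_bij_witness[where i = m and j = "\<lambda>w. (sum (core P w) (NE P), core P w, slack P w)"])
    fix w assume w: "w \<in> graded P (Collect (compatible P)) p q"
    then have comp: "compatible P w" by (simp add: graded_def)
    note tr = tight_core[OF comp]
    have sz: "\<And>i. i \<notin> unshaded P (core P w) \<Longrightarrow> slack P w i = 0" by (rule slack_zero)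
    note N = sum_NE_tight_plus[where c = "slack P w", OF tr sz, unfolded core_plus_slack]
    note E = sum_EE_tight_plus[where c = "slack P w", OF tr sz, unfolded core_plus_slack]
    show "m (sum (core P w) (NE P), core P w, slack P w) = w"
      by (simp add: m_def core_plus_slack)
    show "(case (sum (core P w) (NE P), core P w, slack P w) of
        (k, t, c) \<Rightarrow> gwt f g P t * (\<Prod>i\<in>unshaded P t. f (c i))) = gwt f g P w"
      using gwt_tight_plus[where c = "slack P w" and f = f and g = g, OF tr sz f0, unfolded core_plus_slack] by simp
    have "core P w \<in> gradings P" using w by (auto simp: graded_def gradings_def core_def)
    moreover have "sum (core P w) (EE P) = q" using E w by (simp add: graded_def)
    ultimately have mem: "core P w \<in> T (sum (core P w) (NE P))" using tr by (simp add: T_def graded_def)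
    have p: "sum (core P w) (NE P) + sum (slack P w) (unshaded P (core P w)) = p"
      using N w by (simp add: graded_def)
    then have "slack P w \<in> comps (unshaded P (core P w)) (p - sum (core P w) (NE P))"
      unfolding comps_def by (intro CollectI conjI allI impI sz) simp_all
    then show "(sum (core P w) (NE P), core P w, slack P w) \<in> S"
      unfolding S_def using mem p by (intro SigmaI) simp_all
  next
    fix z assume z: "z \<in> S"
    obtain k t c where zz: "z = (k, t, c)" by (rule prod_cases3[of z])
    have k: "k \<le> p" and "t \<in> T k" and cc: "c \<in> comps (unshaded P t) (p - k)"
      using z unfolding zz S_def by simp_all
    then have t: "t \<in> gradings P" "tight P t" "sum t (NE P) = k" "sum t (EE P) = q"
      by (simp_all add: T_def graded_def)
    have c: "\<And>i. i \<notin> unshaded P t \<Longrightarrow> c i = 0" and sc: "sum c (unshaded P t) = p - k"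
      using cc by (simp_all add: comps_def)
    have mz: "m z = (\<lambda>i. t i + c i)" by (simp add: zz m_def)
    have "(\<lambda>i. t i + c i) \<in> gradings P" using t(1) c by (auto simp: gradings_def NE_def)
    then show "m z \<in> graded P (Collect (compatible P)) p q"
      unfolding mz graded_def
      using compatible_tight_plus[OF t(2) c] sum_NE_tight_plus[OF t(2) c] sum_EE_tight_plus[OF t(2) c] t sc k
      by simp
    show "(sum (core P (m z)) (NE P), core P (m z), slack P (m z)) = z"
      unfolding mz using core_tight_plus[where c = c, OF t(2) c] slack_tight_plus[where c = c, OF t(2) c] by (simp add: zz t(3))
  qed
  also have "\<dots> = (\<Sum>k=0..p. \<Sum>t\<in>T k. \<Sum>c\<in>comps (unshaded P t) (p - k). gwt f g P t * (\<Prod>i\<in>unshaded P t. f (c i)))"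
    unfolding S_def by (rule sum_Sigma3) (simp_all add: finite_comps finite_graded T_def)
  also have "\<dots> = (\<Sum>k=0..p. \<Sum>t\<in>T k. gwt f g P t * fps_nth (Abs_fps f ^ (card (NE P) - q)) (p - k))"
  proof (intro sum.cong HOL.refl)
    fix k t assume "t \<in> T k"
    then have "card (unshaded P t) = card (NE P) - q"
      using card_unshaded[of P t] by (simp add: T_def graded_def)
    then show "(\<Sum>c\<in>comps (unshaded P t) (p - k). gwt f g P t * (\<Prod>i\<in>unshaded P t. f (c i))) =
      gwt f g P t * fps_nth (Abs_fps f ^ (card (NE P) - q)) (p - k)"
      using sum_comps[of "unshaded P t" f "p - k"] by (simp flip: sum_distrib_left)
  qed
  finally show ?thesis unfolding grsum_def T_def by (simp only: sum_distrib_right)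
qed

section \<open>The greedy recursion\<close>

text \<open>The constant term of the power is 1, so an inverse exists although the coefficients form
  no field; commutativity makes it unique, and the \<open>THE\<close> in \<open>varsigma\<close>
  denotes it.\<close>

lemma varsigma_of_nat:
  assumes s0: "s 0 = 1"
  obtains G where "G * Abs_fps s ^ m = 1" "\<And>k. varsigma (int m) k s = fps_nth G k"
proof -
  let ?F = "Abs_fps s"
  define G where "G = fps_left_inverse (?F ^ m) 1"
  have "fps_nth (?F ^ m) 0 = 1" using s0 by (induction m) simp_all
  then have G: "G * ?F ^ m = 1" unfolding G_def by (intro fps_left_inverse) simp
  have s: "(\<lambda>k. if k = 0 then 1 else s k) = s" using s0 by auto
  have "(THE G. G * ?F ^ m = 1) = G"
  proof (rule the_equality)
    fix H assume H: "H * ?F ^ m = 1"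
    have "H = H * (?F ^ m * G)" using G by (simp add: mult.commute)
    also have "\<dots> = G" using H by (simp flip: mult.assoc)
    finally show "H = G" .
  qed (rule G)
  then show ?thesis using that[of G] G by (simp add: varsigma_def s)
qed

text \<open>For a negative index the convention for \<open>varsigma\<close> agrees with inverting
  the zeroth power. This matches the truncated exponent \<open>card (NE P) - q\<close>, both for
  large \<open>q\<close> and for negative \<open>d\<close>.\<close>

lemma varsigma_truncate:
  assumes "s 0 = 1" "0 < k"
  shows "varsigma (d - int q) k s = varsigma (int (nat d - q)) k s"
proof (cases "d - int q < 0")
  case True
  obtain G where G: "G * Abs_fps s ^ 0 = 1" "\<And>k. varsigma (int 0) k s = fps_nth G k"
    using varsigma_of_nat[of s 0, OF assms(1)] by blast
  have "nat d - q = 0" using True by simp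
  then show ?thesis using True G assms(2) by (simp add: varsigma_def)
next
  case False
  then have "d - int q = int (nat d - q)" by simp
  then show ?thesis by (simp only:)
qed

text \<open>For the series in \<open>p\<close>, \<open>grsum_compatible\<close> reads
  \<open>C = T * F ^ m\<close>. Multiplying by the inverse \<open>G\<close> and isolating the term
  \<open>k = 0\<close> turns the sum of the greedy recursion into \<open>C - T\<close>.\<close>

lemma grsum_recursion:
  assumes s0: "s 0 = 1"
  shows "(\<Sum>k\<in>{1..p}. - grsum s g P (Collect (compatible P)) (p - k) q * varsigma (int (card (NE P) - q)) k s) =
    grsum s g P (Collect (compatible P)) p q - grsum s g P (Collect (tight P)) p q"
proof -
  let ?m = "card (NE P) - q"
  obtain G where G: "G * Abs_fps s ^ ?m = 1" "\<And>k. varsigma (int ?m) k s = fps_nth G k"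
    using varsigma_of_nat[of s ?m, OF s0] by blast
  define C where "C = (\<lambda>p. grsum s g P (Collect (compatible P)) p q)"
  define T where "T = (\<lambda>p. grsum s g P (Collect (tight P)) p q)"
  have "Abs_fps C = Abs_fps T * Abs_fps s ^ ?m"
    by (rule fps_ext) (simp add: C_def T_def fps_mult_nth grsum_compatible[of s, OF s0])
  then have "G * Abs_fps C = Abs_fps T * (G * Abs_fps s ^ ?m)" by (simp add: mult.left_commute)
  then have "G * Abs_fps C = Abs_fps T" by (simp add: G(1))
  then have "T p = fps_nth (G * Abs_fps C) p" by simp
  also have "\<dots> = (\<Sum>k=0..p. fps_nth G k * C (p - k))" by (simp add: fps_mult_nth)
  also have "\<dots> = fps_nth G 0 * C p + (\<Sum>k=1..p. fps_nth G k * C (p - k))"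
    by (simp add: sum.atLeast_Suc_atMost)
  finally have T: "T p = fps_nth G 0 * C p + (\<Sum>k=1..p. fps_nth G k * C (p - k))" .
  have "fps_nth (Abs_fps s ^ ?m) 0 = 1" using s0 by (induction ?m) (simp_all add: fps_power_zeroth)
  then have "fps_nth G 0 = 1" using arg_cong[OF G(1), of "\<lambda>F. fps_nth F 0"] by simp
  then have "C p - T p = (\<Sum>k=1..p. - C (p - k) * fps_nth G k)"
    using T by (simp add: sum_negf mult.commute)
  then show ?thesis by (simp add: G(2) C_def T_def)
qed

section \<open>Coefficientwise maximum and nonnegativity\<close>

lemma lookup_tmax:
  "Poly_Mapping.lookup (tmax f g) e = max (Poly_Mapping.lookup f e) (Poly_Mapping.lookup g e)"
proof -
  have "{e. max (Poly_Mapping.lookup f e) (Poly_Mapping.lookup g e) \<noteq> 0} \<subseteq> Poly_Mapping.keys f \<union> Poly_Mapping.keys g"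
    by (auto simp: in_keys_iff max_def split: if_splits)
  then have "finite {e. max (Poly_Mapping.lookup f e) (Poly_Mapping.lookup g e) \<noteq> 0}"
    by (rule finite_subset) simp
  then show ?thesis unfolding tmax_def by simp
qed

text \<open>In each coefficient the maximum is \<open>c - min t t'\<close>, and that minimum
  vanishes.\<close>

lemma tmax_diff:
  assumes "\<And>e. 0 \<le> Poly_Mapping.lookup t e" "\<And>e. 0 \<le> Poly_Mapping.lookup t' e" "t = 0 \<or> t' = 0"
  shows "tmax (c - t) (c - t') = c"
proof (rule poly_mapping_eqI)
  fix e show "Poly_Mapping.lookup (tmax (c - t) (c - t')) e = Poly_Mapping.lookup c e"
    using assms(1)[of e] assms(2)[of e] assms(3) by (auto simp: lookup_tmax lookup_minus)
qed

text \<open>A class visibly closed under products that contains every \<open>pseq l i k\<close>,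
  including the zeros beyond \<open>l\<close>. It yields nonnegative coefficients of weights without
  expanding a convolution.\<close>

definition zero_or_monomial :: "ipoly \<Rightarrow> bool" where
  "zero_or_monomial f \<longleftrightarrow> f = 0 \<or> (\<exists>m. f = Poly_Mapping.single m 1)"

lemma zero_or_monomial_one: "zero_or_monomial 1"
  unfolding zero_or_monomial_def by (metis single_one)

lemma zero_or_monomial_mult: "zero_or_monomial f \<Longrightarrow> zero_or_monomial g \<Longrightarrow> zero_or_monomial (f * g)"
  unfolding zero_or_monomial_def by (auto simp: mult_single)

lemma zero_or_monomial_prod: "(\<And>i. i \<in> A \<Longrightarrow> zero_or_monomial (f i)) \<Longrightarrow> zero_or_monomial (prod f A)"
  by (induction A rule: infinite_finite_induct) (simp_all add: zero_or_monomial_one zero_or_monomial_mult)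

lemma zero_or_monomial_pseq: "zero_or_monomial (pseq l i k)"
  using zero_or_monomial_one by (auto simp: pseq_def pvar_def zero_or_monomial_def)

lemma zero_or_monomial_nonneg: "zero_or_monomial f \<Longrightarrow> 0 \<le> Poly_Mapping.lookup f e"
  by (auto simp: zero_or_monomial_def lookup_single when_def)

lemma grsum_pseq_nonneg: "0 \<le> Poly_Mapping.lookup (grsum (pseq l i) (pseq l' i') P W p q) e"
  unfolding grsum_def lookup_sum gwt_def
  by (intro sum_nonneg zero_or_monomial_nonneg zero_or_monomial_mult zero_or_monomial_prod zero_or_monomial_pseq)

lemma pseq_0 [simp]: "pseq l i 0 = 1"
  by (simp add: pseq_def)

lemma grsum_compatible_0_0:
  assumes "f 0 = 1" "g 0 = 1"
  shows "grsum f g P (Collect (compatible P)) 0 0 = 1"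
proof -
  have "graded P (Collect (compatible P)) 0 0 = {\<lambda>_. 0}"
  proof (rule set_eqI)
    fix w
    have "w = (\<lambda>_. 0)" if "w \<in> gradings P" "sum w (NE P) = 0" "sum w (EE P) = 0"
    proof
      fix i show "w i = 0"
        using that by (cases "i < length P") (auto simp: gradings_def NE_def EE_def)
    qed
    moreover have "compatible P (\<lambda>_. 0)" by (simp add: compatible_iff)
    ultimately show "w \<in> graded P (Collect (compatible P)) 0 0 \<longleftrightarrow> w \<in> {\<lambda>_. 0}"
      by (auto simp: graded_def gradings_def)
  qed
  then show ?thesis using assms by (simp add: grsum_def gwt_def)
qed

lemma grsum_tight_nonzero:
  assumes "grsum f g P (Collect (tight P)) p q \<noteq> 0" "hugging P" "p \<noteq> 0 \<or> q \<noteq> 0"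
  shows "p * card (NE P) < q * card (EE P)"
proof -
  have "graded P (Collect (tight P)) p q \<noteq> {}"
    using assms(1) unfolding grsum_def by (metis sum.empty)
  then obtain w where w: "tight P w" "sum w (NE P) = p" "sum w (EE P) = q"
    by (auto simp: graded_def)
  then show ?thesis using tight_slope[OF w(1) assms(2)] assms(3) by simp
qed

declare cgr.simps [simp del]

lemma cgr_eq_grsum:
  "cgr d1 d2 l1 l2 p q =
   grsum (pseq l1 1) (pseq l2 2) (dyck_path (nat d1) (nat d2))
     (Collect (compatible (dyck_path (nat d1) (nat d2)))) p q"
proof (induction "p + q" arbitrary: p q rule: less_induct)
  case less
  define P where "P = dyck_path (nat d1) (nat d2)"
  define f g where "f = pseq l1 1" and "g = pseq l2 2"
  define C where "C = grsum f g P (Collect (compatible P))"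
  define T where "T = grsum f g P (Collect (tight P)) p q"
  define T' where "T' = grsum g f (dual P) (Collect (tight (dual P))) q p"
  have cards: "card (NE P) = nat d2" "card (EE P) = nat d1"
    by (simp_all add: P_def card_dyck_path)
  have fg0: "f 0 = 1" "g 0 = 1" by (simp_all add: f_def g_def)
  have IH: "cgr d1 d2 l1 l2 p' q' = C p' q'" if "p' + q' < p + q" for p' q'
    using less that by (simp add: C_def P_def f_def g_def)
  have dual: "grsum g f (dual P) (Collect (compatible (dual P))) q' p' = C p' q'" for p' q'
    unfolding C_def by (rule grsum_dual) (simp add: compatible_dual)
  show ?case
  proof (cases "p = 0 \<and> q = 0")
    case True
    then show ?thesis using grsum_compatible_0_0[of f g P, OF fg0]
      by (subst cgr.simps) (simp add: f_def g_def P_def)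
  next
    case False
    have "(\<Sum>k\<in>{1..p}. - cgr d1 d2 l1 l2 (p - k) q * varsigma (d2 - int q) k f) =
          (\<Sum>k\<in>{1..p}. - C (p - k) q * varsigma (int (card (NE P) - q)) k f)"
      by (rule sum.cong) (auto simp: IH cards varsigma_truncate[of f, OF fg0(1)])
    also have "\<dots> = C p q - T"
      unfolding C_def T_def by (rule grsum_recursion[of f, OF fg0(1)])
    finally have S1: "(\<Sum>k\<in>{1..p}. - cgr d1 d2 l1 l2 (p - k) q * varsigma (d2 - int q) k f) = C p q - T" .
    \<comment> \<open>The second argument of the maximum is the first one for the reversed path,
      with weights and degrees exchanged.\<close>
    have "(\<Sum>k\<in>{1..q}. - cgr d1 d2 l1 l2 p (q - k) * varsigma (d1 - int p) k g) =
          (\<Sum>k\<in>{1..q}. - grsum g f (dual P) (Collect (compatible (dual P))) (q - k) p *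
             varsigma (int (card (NE (dual P)) - p)) k g)"
      by (rule sum.cong) (auto simp: IH dual cards varsigma_truncate[of g, OF fg0(2)])
    also have "\<dots> = C p q - T'"
      unfolding T'_def by (subst grsum_recursion[of g, OF fg0(2)]) (simp only: dual)
    finally have S2: "(\<Sum>k\<in>{1..q}. - cgr d1 d2 l1 l2 p (q - k) * varsigma (d1 - int p) k g) = C p q - T'" .
    have hug: "hugging P" unfolding P_def by (rule hugging_dyck_path)
    have "T = 0 \<or> T' = 0"
      using grsum_tight_nonzero[of f g P p q] grsum_tight_nonzero[of g f "dual P" q p]
        hug hugging_dual[OF hug] False by (fastforce simp: T_def T'_def)
    moreover have "0 \<le> Poly_Mapping.lookup T e" "0 \<le> Poly_Mapping.lookup T' e" for e
      unfolding T_def T'_def f_def g_def by (rule grsum_pseq_nonneg)+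
    ultimately have "tmax (C p q - T) (C p q - T') = C p q" by (intro tmax_diff)
    then have "cgr d1 d2 l1 l2 p q = C p q"
      using S1 S2 False unfolding f_def g_def by (subst cgr.simps) auto
    then show ?thesis by (simp add: C_def f_def g_def P_def)
  qed
qed

theorem theorem3p13:
  fixes d1 d2 :: int and l1 l2 :: enat and p q :: nat
  assumes "l1 \<ge> 1" and "l2 \<ge> 1"
  shows "cgr d1 d2 l1 l2 p q =
    (let P = dyck_path (nat d1) (nat d2) in
       \<Sum>w \<in> {w \<in> gradings P. compatible P w \<and>
                 (\<Sum>j\<in>NE P. w j) = p \<and> (\<Sum>i\<in>EE P. w i) = q}. wt l1 l2 P w)"
  unfolding cgr_eq_grsum grsum_def graded_def gwt_def wt_def Let_def by simp

end
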